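(* For every $\epsilon>0$ there is a constant $C_\epsilon$ such that for all $Q\ge 1$ and all integers $M\ge Q^{20}$, the function $$\Lambda_Q(n):=\sum_{Q/2\le q<Q}\frac{\mu(q)}{\phi(q)}\,c_q(n)$$ satisfies $$\|\Lambda_Q\|_{U^3[M]}\le C_\epsilon\,Q^{\epsilon-3/8}.$$
   Context: $\mu$ is the M\"obius function, $\phi$ is Euler's totient function, $e(t)=e^{2\pi i t}$, and $c_q(n)=\sum_{1\le a\le q,\ (a,q)=1}e(-an/q)$ is the Ramanujan sum; the sum defining $\Lambda_Q$ is over integers $q$. For a finitely supported $f:\mathbb Z\to\mathbb C$ put $\triangle_hf(x)=f(x)\overline{f(x+h)}$, $\triangle_{h_1,\dots,h_s}f=\triangle_{h_s}(\triangle_{h_1,\dots,h_{s-1}}f)$, and $\|f\|_{U^3(\mathbb Z)}^8=\sum_{x,h_1,h_2,h_3\in\mathbb Z}\triangle_{h_1,h_2,h_3}f(x)$. With $[M]=\{1,\dots,M\}$, the normalized norm is $\|f\|_{U^3[M]}=\|f\mathbf 1_{[M]}\|_{U^3(\mathbb Z)}/\|\mathbf 1_{[M]}\|_{U^3(\mathbb Z)}$. *)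

theory Defs
  imports
    "HOL-Analysis.Analysis"
    "HOL-Number_Theory.Totient"
    "HOL-Computational_Algebra.Squarefree"
begin

definition moebius_mu :: "nat \<Rightarrow> int" where
  "moebius_mu n = (if squarefree n then (-1) ^ card (prime_factors n) else 0)"

definition e :: "real \<Rightarrow> complex" where
  "e t = exp (2 * of_real pi * \<i> * of_real t)"

definition ramanujan_sum :: "nat \<Rightarrow> int \<Rightarrow> complex" where
  "ramanujan_sum q n =
     (\<Sum>a | 1 \<le> a \<and> a \<le> q \<and> coprime a q. e (- (real a * real_of_int n / real q)))"

text \<open>The parameter \<open>Q\<close> is real; only the summation variable \<open>q\<close> is an integer.\<close>

definition Lambda_Q :: "real \<Rightarrow> int \<Rightarrow> complex" where
  "Lambda_Q Q n =
     (\<Sum>q | Q / 2 \<le> real q \<and> real q < Q.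
        of_int (moebius_mu q) / of_nat (totient q) * ramanujan_sum q n)"

definition mult_deriv :: "int \<Rightarrow> (int \<Rightarrow> complex) \<Rightarrow> int \<Rightarrow> complex" where
  "mult_deriv h f = (\<lambda>x. f x * cnj (f (x + h)))"

definition mult_derivs :: "int list \<Rightarrow> (int \<Rightarrow> complex) \<Rightarrow> int \<Rightarrow> complex" where
  "mult_derivs hs f = fold mult_deriv hs f"

text \<open>
  The norm is the nonnegative eighth root of the sum. For finitely supported \<open>f\<close>, the
  only case of interest, the sum has finitely many nonzero terms and is a nonnegative
  real, so that taking the real part loses nothing; see \<open>U3_norm_power8\<close> below.
\<close>

definition U3_norm :: "(int \<Rightarrow> complex) \<Rightarrow> real" where
  "U3_norm f =
     root 8 (Re (\<Sum>\<^sub>\<infinity>(x, h1, h2, h3)\<in>UNIV. mult_derivs [h1, h2, h3] f x))"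

definition U3_norm_interval :: "int \<Rightarrow> (int \<Rightarrow> complex) \<Rightarrow> real" where
  "U3_norm_interval M f =
     U3_norm (\<lambda>n. f n * indicator {1..M} n) / U3_norm (indicator {1..M})"

lemma U3_norm_power8:
  assumes fin: "finite {x. f x \<noteq> 0}"
  shows "complex_of_real (U3_norm f ^ 8) =
           (\<Sum>\<^sub>\<infinity>(x, h1, h2, h3)\<in>UNIV. mult_derivs [h1, h2, h3] f x)"
    and "U3_norm f \<ge> 0"
proof -
  define A where "A = {x. f x \<noteq> 0}"
  define D where "D = (\<lambda>(x, y). y - x) ` (A \<times> A)"
  define G where "G = (\<lambda>h1 h2. mult_deriv h2 (mult_deriv h1 f))"
  have finA: "finite A" and finD: "finite D"
    using fin by (auto simp: A_def D_def)
  have memD: "h \<in> D" if "x \<in> A" "x + h \<in> A" for x h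
    using that unfolding D_def by (intro image_eqI[of _ _ "(x, x + h)"]) auto
  have G0: "G h1 h2 x = 0" if "x \<notin> A" for h1 h2 x
    using that by (auto simp: G_def mult_deriv_def A_def)
  have term_eq: "mult_derivs [h1, h2, h3] f x = G h1 h2 x * cnj (G h1 h2 (x + h3))"
    for h1 h2 h3 x
    by (simp add: mult_derivs_def G_def mult_deriv_def)
  have zero: "mult_derivs [h1, h2, h3] f x = 0"
    if "(x, h1, h2, h3) \<notin> A \<times> D \<times> D \<times> D" for x h1 h2 h3
  proof (rule ccontr)
    assume "mult_derivs [h1, h2, h3] f x \<noteq> 0"
    then have "x \<in> A" "x + h1 \<in> A" "x + h2 \<in> A" "x + h3 \<in> A"
      by (auto simp: mult_derivs_def mult_deriv_def A_def)
    then show False using memD that by blast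
  qed
  have inner: "(\<Sum>h\<in>D. G h1 h2 (x + h)) = (\<Sum>y\<in>A. G h1 h2 y)" if "x \<in> A" for h1 h2 x
  proof -
    have "(\<Sum>h\<in>D. G h1 h2 (x + h)) = (\<Sum>y\<in>(+) x ` D. G h1 h2 y)"
      by (simp add: sum.reindex)
    also have "\<dots> = (\<Sum>y\<in>A. G h1 h2 y)"
    proof (rule sum.mono_neutral_right)
      show "A \<subseteq> (+) x ` D"
        using memD[OF that] by (metis add_diff_cancel_left' diff_add_cancel add.commute image_eqI subsetI)
    qed (auto simp: finD G0)
    finally show ?thesis .
  qed
  let ?S = "\<Sum>\<^sub>\<infinity>(x, h1, h2, h3)\<in>UNIV. mult_derivs [h1, h2, h3] f x"
  have "?S = (\<Sum>\<^sub>\<infinity>(x, h1, h2, h3)\<in>A \<times> D \<times> D \<times> D. mult_derivs [h1, h2, h3] f x)"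
    by (rule infsum_cong_neutral) (use zero in auto)
  also have "\<dots> = (\<Sum>(x, h1, h2, h3)\<in>A \<times> D \<times> D \<times> D. mult_derivs [h1, h2, h3] f x)"
    using finA finD by simp
  also have "\<dots> = (\<Sum>x\<in>A. \<Sum>h1\<in>D. \<Sum>h2\<in>D. \<Sum>h3\<in>D. mult_derivs [h1, h2, h3] f x)"
    by (simp add: sum.cartesian_product)
  also have "\<dots> = (\<Sum>x\<in>A. \<Sum>h1\<in>D. \<Sum>h2\<in>D. G h1 h2 x * cnj (\<Sum>y\<in>A. G h1 h2 y))"
    by (simp only: term_eq sum_distrib_left[symmetric] cnj_sum[symmetric] inner cong: sum.cong)
  also have "\<dots> = (\<Sum>h1\<in>D. \<Sum>h2\<in>D. \<Sum>x\<in>A. G h1 h2 x * cnj (\<Sum>y\<in>A. G h1 h2 y))"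
    by (subst sum.swap, rule sum.cong[OF refl], rule sum.swap)
  also have "\<dots> = complex_of_real (\<Sum>h1\<in>D. \<Sum>h2\<in>D. (cmod (\<Sum>x\<in>A. G h1 h2 x))\<^sup>2)"
    by (simp add: sum_distrib_right[symmetric] complex_norm_square[symmetric] del: cnj_sum)
  finally obtain r where r: "?S = complex_of_real r" "r \<ge> 0"
    by (metis (no_types, lifting) sum_nonneg zero_le_power2)
  then have "U3_norm f = root 8 r"
    by (simp add: U3_norm_def)
  with r show "complex_of_real (U3_norm f ^ 8) = ?S" and "U3_norm f \<ge> 0"
    by simp_all
qed

end

theory Submission
  imports Defs
begin

text \<open>
  Expanding \<open>\<Lambda>\<^sub>Q\<close> into exponentials \<open>e(-an/q)\<close> turns the eighth power of the \<open>U\<^sup>3\<close> norm into a sum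
  over 8-tuples of fractions \<open>a/q\<close> placed on the vertices of a cube. Unless four linear
  combinations of these fractions are all integers, one of the variables runs over a geometric
  progression whose ratio is a nontrivial root of unity of order at most \<open>Q\<^sup>8\<close>; since
  \<open>M \<ge> Q\<^sup>2\<^sup>0\<close>, these tuples contribute at most a constant times \<open>Q\<^sup>-\<^sup>4\<close> after normalization.

  On the resonant tuples the coefficient \<open>1/\<phi>(q)\<close> is at most \<open>(Q/2)\<^sup>-\<^sup>\<gamma> q\<^sup>\<gamma>/\<phi>(q)\<close> with \<open>\<gamma> = 3/8 - \<delta>\<close>
  (a Rankin trick). The eight factors \<open>(Q/2)\<^sup>-\<^sup>\<gamma>\<close> give the gain, and the remaining weight is
  multiplicative, so by the Chinese remainder theorem its sum over resonant tuples is a product over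
  primes \<open>p < Q\<close>. Any nonzero resonant tuple modulo \<open>p\<close> has at least four nonzero entries, which
  makes the local factor \<open>1 + O(p\<^sup>-\<^sup>1\<^sup>-\<^sup>8\<^sup>\<delta>)\<close>, and the product converges.
\<close>

section \<open>Sums over residues\<close>

text \<open>Functions on the residues modulo \<open>P\<close> are represented by periodic functions
  on \<open>int\<close>, so shifts, reflections and reductions to a divisor need no quotient
  type.\<close>

definition mod_invariant :: "int \<Rightarrow> (int \<Rightarrow> 'a) \<Rightarrow> bool" where
  "mod_invariant P f \<longleftrightarrow> (\<forall>x y. x mod P = y mod P \<longrightarrow> f x = f y)"

lemma mod_invariantD: "mod_invariant P f \<Longrightarrow> x mod P = y mod P \<Longrightarrow> f x = f y"
  unfolding mod_invariant_def by blast

lemma sum_residues_shift: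
  fixes f :: "int \<Rightarrow> 'a::comm_monoid_add"
  assumes "P > 0" "mod_invariant P f"
  shows "(\<Sum>x\<in>{0..<P}. f (x + c)) = (\<Sum>x\<in>{0..<P}. f x)"
proof (rule sum.reindex_bij_witness[where i = "\<lambda>x. (x - c) mod P" and j = "\<lambda>x. (x + c) mod P"])
  fix x assume "x \<in> {0..<P}"
  then show "((x + c) mod P - c) mod P = x" "((x - c) mod P + c) mod P = x"
    by (simp_all add: mod_simps)
  show "f ((x + c) mod P) = f (x + c)"
    by (rule mod_invariantD[OF assms(2)]) simp
qed (use assms(1) in auto)

lemma sum_residues_reflect:
  fixes f :: "int \<Rightarrow> 'a::comm_monoid_add"
  assumes "P > 0" "mod_invariant P f"
  shows "(\<Sum>x\<in>{0..<P}. f (c - x)) = (\<Sum>x\<in>{0..<P}. f x)"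
proof (rule sum.reindex_bij_witness[where i = "\<lambda>x. (c - x) mod P" and j = "\<lambda>x. (c - x) mod P"])
  fix x assume "x \<in> {0..<P}"
  then show "(c - (c - x) mod P) mod P = x" "(c - (c - x) mod P) mod P = x"
    by (simp_all add: mod_simps)
  show "f ((c - x) mod P) = f (c - x)"
    by (rule mod_invariantD[OF assms(2)]) simp
qed (use assms(1) in auto)

text \<open>Chinese remainder theorem: \<open>x\<close> maps to \<open>(x mod p, x mod m)\<close>
  injectively by coprimality, hence onto because both sides have \<open>p * m\<close>
  elements.\<close>

lemma sum_residues_mult:
  fixes f g :: "int \<Rightarrow> 'a::comm_semiring_0"
  assumes pos: "p > 0" "m > 0" and cop: "coprime p m"
    and f: "mod_invariant p f" and g: "mod_invariant m g"
  shows "(\<Sum>x\<in>{0..<p * m}. f x * g x) = (\<Sum>x\<in>{0..<p}. f x) * (\<Sum>x\<in>{0..<m}. g x)"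
proof -
  define \<phi> where "\<phi> = (\<lambda>x. (x mod p, x mod m))"
  have inj: "inj_on \<phi> {0..<p * m}"
  proof (rule inj_onI)
    fix x y assume x: "x \<in> {0..<p * m}" and y: "y \<in> {0..<p * m}" and "\<phi> x = \<phi> y"
    then have "[x = y] (mod p)" "[x = y] (mod m)"
      by (auto simp: \<phi>_def cong_def)
    then have "[x = y] (mod p * m)"
      using cop by (rule coprime_cong_mult)
    then show "x = y" using x y by (simp add: cong_def)
  qed
  have "\<phi> ` {0..<p * m} = {0..<p} \<times> {0..<m}"
  proof (rule card_subset_eq)
    show "\<phi> ` {0..<p * m} \<subseteq> {0..<p} \<times> {0..<m}" using pos by (auto simp: \<phi>_def)
    show "card (\<phi> ` {0..<p * m}) = card ({0..<p} \<times> {0..<m})"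
      using pos by (simp add: card_image[OF inj] nat_mult_distrib)
  qed auto
  then have "(\<Sum>x\<in>{0..<p}. f x) * (\<Sum>x\<in>{0..<m}. g x) = (\<Sum>(x, y)\<in>\<phi> ` {0..<p * m}. f x * g y)"
    by (simp add: sum_product sum.cartesian_product)
  also have "\<dots> = (\<Sum>x\<in>{0..<p * m}. f (x mod p) * g (x mod m))"
    by (simp add: sum.reindex[OF inj]) (simp add: \<phi>_def)
  also have "\<dots> = (\<Sum>x\<in>{0..<p * m}. f x * g x)"
    by (intro sum.cong arg_cong2[of _ _ _ _ "(*)"] mod_invariantD[OF f] mod_invariantD[OF g]) auto
  finally show ?thesis by simp
qed

text \<open>The form \<open>cube_weight W s t\<^sub>1 t\<^sub>2 t\<^sub>3\<close> is the product of \<open>W\<close> over the eight frequencies of a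
  resonant cube: the four parallel edges carry the frequencies \<open>(s + t\<^sub>i, t\<^sub>i)\<close>, where
  \<open>t\<^sub>1 + t\<^sub>4 = t\<^sub>2 + t\<^sub>3\<close>.\<close>

definition cube_weight :: "(int \<Rightarrow> real) \<Rightarrow> int \<Rightarrow> int \<Rightarrow> int \<Rightarrow> int \<Rightarrow> real" where
  "cube_weight W s t1 t2 t3 =
     W t1 * W (s + t1) * (W t2 * W (s + t2)) * (W t3 * W (s + t3)) *
     (W (t2 + t3 - t1) * W (s + (t2 + t3 - t1)))"

definition cube_sum :: "int \<Rightarrow> (int \<Rightarrow> real) \<Rightarrow> real" where
  "cube_sum P W = (\<Sum>s\<in>{0..<P}. \<Sum>t1\<in>{0..<P}. \<Sum>t2\<in>{0..<P}. \<Sum>t3\<in>{0..<P}. cube_weight W s t1 t2 t3)"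

lemma cube_weight_cong:
  assumes W: "mod_invariant P W"
    and "s mod P = s' mod P" "t1 mod P = t1' mod P" "t2 mod P = t2' mod P" "t3 mod P = t3' mod P"
  shows "cube_weight W s t1 t2 t3 = cube_weight W s' t1' t2' t3'"
  unfolding cube_weight_def
  by (intro arg_cong2[of _ _ _ _ "(*)"] mod_invariantD[OF W] mod_add_cong mod_diff_cong assms)

lemma mod_invariant_cube_weight:
  assumes W: "mod_invariant P W"
  shows "mod_invariant P (\<lambda>t3. cube_weight W s t1 t2 t3)"
    and "mod_invariant P (\<lambda>t2. \<Sum>t3\<in>A. cube_weight W s t1 t2 t3)"
    and "mod_invariant P (\<lambda>t1. \<Sum>t2\<in>A. \<Sum>t3\<in>A. cube_weight W s t1 t2 t3)"
    and "mod_invariant P (\<lambda>s. \<Sum>t1\<in>A. \<Sum>t2\<in>A. \<Sum>t3\<in>A. cube_weight W s t1 t2 t3)"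
  unfolding mod_invariant_def
  by (auto intro!: sum.cong cube_weight_cong[OF W])

lemma cube_weight_mult:
  "cube_weight (\<lambda>x. V x * W x) s t1 t2 t3 = cube_weight V s t1 t2 t3 * cube_weight W s t1 t2 t3"
  by (simp add: cube_weight_def mult_ac)

lemma cube_weight_nonneg: "(\<And>x. 0 \<le> W x) \<Longrightarrow> 0 \<le> cube_weight W s t1 t2 t3"
  by (simp add: cube_weight_def)

lemma cube_sum_nonneg: "(\<And>x. 0 \<le> W x) \<Longrightarrow> 0 \<le> cube_sum P W"
  by (simp add: cube_sum_def cube_weight_nonneg sum_nonneg)

text \<open>The four sums are split one at a time, innermost first. Each application of the Chinese
  remainder theorem is legitimate because a partial sum is still periodic in every remaining
  variable.\<close>

lemma cube_sum_mult:
  assumes pos: "p > 0" "m > 0" and cop: "coprime p m"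
    and V: "mod_invariant p V" and W: "mod_invariant m W"
  shows "cube_sum (p * m) (\<lambda>x. V x * W x) = cube_sum p V * cube_sum m W"
proof -
  note mult = sum_residues_mult[OF pos cop]
  note inv = mod_invariant_cube_weight[OF V] mod_invariant_cube_weight[OF W]
  have "(\<Sum>t3\<in>{0..<p * m}. cube_weight V s t1 t2 t3 * cube_weight W s t1 t2 t3) =
    (\<Sum>t3\<in>{0..<p}. cube_weight V s t1 t2 t3) * (\<Sum>t3\<in>{0..<m}. cube_weight W s t1 t2 t3)" for s t1 t2
    by (rule mult; rule inv)
  moreover have "(\<Sum>t2\<in>{0..<p * m}. (\<Sum>t3\<in>{0..<p}. cube_weight V s t1 t2 t3) * (\<Sum>t3\<in>{0..<m}. cube_weight W s t1 t2 t3)) =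
    (\<Sum>t2\<in>{0..<p}. \<Sum>t3\<in>{0..<p}. cube_weight V s t1 t2 t3) * (\<Sum>t2\<in>{0..<m}. \<Sum>t3\<in>{0..<m}. cube_weight W s t1 t2 t3)" for s t1
    by (rule mult; rule inv)
  moreover have "(\<Sum>t1\<in>{0..<p * m}. (\<Sum>t2\<in>{0..<p}. \<Sum>t3\<in>{0..<p}. cube_weight V s t1 t2 t3) * (\<Sum>t2\<in>{0..<m}. \<Sum>t3\<in>{0..<m}. cube_weight W s t1 t2 t3)) =
    (\<Sum>t1\<in>{0..<p}. \<Sum>t2\<in>{0..<p}. \<Sum>t3\<in>{0..<p}. cube_weight V s t1 t2 t3) * (\<Sum>t1\<in>{0..<m}. \<Sum>t2\<in>{0..<m}. \<Sum>t3\<in>{0..<m}. cube_weight W s t1 t2 t3)" for s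
    by (rule mult; rule inv)
  moreover have "(\<Sum>s\<in>{0..<p * m}. (\<Sum>t1\<in>{0..<p}. \<Sum>t2\<in>{0..<p}. \<Sum>t3\<in>{0..<p}. cube_weight V s t1 t2 t3) * (\<Sum>t1\<in>{0..<m}. \<Sum>t2\<in>{0..<m}. \<Sum>t3\<in>{0..<m}. cube_weight W s t1 t2 t3)) =
    cube_sum p V * cube_sum m W"
    unfolding cube_sum_def by (rule mult; rule inv)
  ultimately show ?thesis
    by (simp add: cube_sum_def cube_weight_mult)
qed

text \<open>This is a multiplicative function of the reduced denominator of the fraction
  \<open>x / \<Prod>A\<close>: for a set of primes \<open>A\<close>, those not dividing
  \<open>x\<close> are exactly the ones that survive in the denominator.\<close>

definition local_weight :: "(int \<Rightarrow> real) \<Rightarrow> int set \<Rightarrow> int \<Rightarrow> real" where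
  "local_weight u A x = (\<Prod>p\<in>A. if p dvd x then 1 else u p)"

lemma mod_invariant_dvd:
  assumes "p dvd P"
  shows "mod_invariant P (\<lambda>x. if p dvd x then a else b)"
  unfolding mod_invariant_def
proof (intro allI impI)
  fix x y assume "x mod P = y mod P"
  then have "p dvd x \<longleftrightarrow> p dvd y"
    using dvd_mod_iff[OF assms, of x] dvd_mod_iff[OF assms, of y] by simp
  then show "(if p dvd x then a else b) = (if p dvd y then a else b)" by simp
qed

lemma mod_invariant_local_weight: "mod_invariant (\<Prod>A) (local_weight u A)"
proof (cases "finite A")
  case True
  show ?thesis
    unfolding mod_invariant_def local_weight_def
  proof (intro allI impI prod.cong refl)
    fix x y p assume xy: "x mod \<Prod>A = y mod \<Prod>A" and "p \<in> A"
    then have "p dvd \<Prod>A" using True by auto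
    from mod_invariantD[OF mod_invariant_dvd[OF this] xy]
    show "(if p dvd x then 1 else u p) = (if p dvd y then 1 else u p)" .
  qed
qed (simp add: mod_invariant_def local_weight_def)

lemma cube_sum_local_weight:
  assumes "finite A" "\<And>p. p \<in> A \<Longrightarrow> prime p"
  shows "cube_sum (\<Prod>A) (local_weight u A) =
    (\<Prod>p\<in>A. cube_sum p (\<lambda>x. if p dvd x then 1 else u p))"
  using assms
proof (induction A rule: finite_induct)
  case empty
  have "{0..<1} = {0::int}" by auto
  then show ?case by (simp add: cube_sum_def cube_weight_def local_weight_def)
next
  case (insert p A)
  have cop: "coprime p (\<Prod>A)"
    using insert by (intro prod_coprime_right primes_coprime) auto
  have "cube_sum (p * \<Prod>A) (\<lambda>x. (if p dvd x then 1 else u p) * local_weight u A x) =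
    cube_sum p (\<lambda>x. if p dvd x then 1 else u p) * cube_sum (\<Prod>A) (local_weight u A)"
    using insert by (intro cube_sum_mult cop mod_invariant_dvd mod_invariant_local_weight)
      (auto intro!: prod_pos simp: prime_gt_0_int)
  moreover have "local_weight u (insert p A) = (\<lambda>x. (if p dvd x then 1 else u p) * local_weight u A x)"
    using insert by (simp add: local_weight_def fun_eq_iff)
  ultimately show ?case using insert by simp
qed

section \<open>Local factors\<close>

text \<open>Here \<open>E\<close> is the concentrated part of \<open>K\<close> and \<open>b\<close>
  a uniform background. In the product of four factors, replacing one \<open>E\<close> by
  \<open>b\<close> leaves three factors whose arguments are independent linear forms in
  \<open>t1\<close>, \<open>t2\<close>, \<open>t3\<close>, so the triple sum splits into single
  sums. Only the term with four factors \<open>E\<close> is dependent; there one factor is bounded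
  by its supremum \<sigma>.\<close>

lemma additive_energy_le:
  fixes K E :: "int \<Rightarrow> real"
  assumes P: "P > 0" and E: "mod_invariant P E" "\<And>t. 0 \<le> E t" "\<And>t. E t \<le> \<sigma>"
    and b: "b \<ge> 0" and K: "\<And>t. 0 \<le> K t" "\<And>t. K t \<le> E t + b"
    and m: "(\<Sum>t\<in>{0..<P}. E t) = m"
  shows "(\<Sum>t1\<in>{0..<P}. \<Sum>t2\<in>{0..<P}. \<Sum>t3\<in>{0..<P}. K t1 * K t2 * K t3 * K (t2 + t3 - t1))
    \<le> \<sigma> * m ^ 3 + b * (m ^ 3 + m ^ 2 * (m + P * b) + m * (m + P * b) ^ 2 + (m + P * b) ^ 3)"
proof -
  define R where "R = {0..<P}"
  define L where "L = (\<lambda>t. E t + b)"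
  have L: "(\<Sum>t\<in>R. L t) = m + P * b" and m': "(\<Sum>t\<in>R. E t) = m"
    using P m by (simp_all add: L_def R_def sum.distrib)
  have shift3: "(\<Sum>t3\<in>R. E (t2 + t3 - t1)) = m" for t1 t2
    using sum_residues_shift[OF P E(1), of "t2 - t1"] m by (simp add: R_def algebra_simps)
  have shift2: "(\<Sum>t2\<in>R. E (t2 + t3 - t1)) = m" for t1 t3
    using sum_residues_shift[OF P E(1), of "t3 - t1"] m by (simp add: R_def algebra_simps)
  have shift1: "(\<Sum>t1\<in>R. E (t2 + t3 - t1)) = m" for t2 t3
    using sum_residues_reflect[OF P E(1), of "t2 + t3"] m by (simp add: R_def)
  have le: "K t1 * K t2 * K t3 * K t4 \<le>
      E t1 * E t2 * E t3 * \<sigma> + b * (E t1 * (E t2 * E t4)) + b * (E t1 * (L t3 * E t4))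
      + b * (L t2 * (L t3 * E t4)) + b * (L t1 * (L t2 * L t3))" for t1 t2 t3 t4
  proof -
    have "K t1 * K t2 * K t3 * K t4 \<le> L t1 * L t2 * L t3 * L t4"
      unfolding L_def using K E b by (intro mult_mono mult_nonneg_nonneg add_nonneg_nonneg) auto
    \<comment> \<open>The background is split off from the factors in the order 4, 1, 2, 3. This
      telescoping gives five terms instead of sixteen.\<close>
    also have "\<dots> = E t1 * E t2 * E t3 * E t4 + b * (E t1 * (E t2 * E t4)) + b * (E t1 * (L t3 * E t4))
      + b * (L t2 * (L t3 * E t4)) + b * (L t1 * (L t2 * L t3))"
      by (simp add: L_def algebra_simps)
    also have "E t1 * E t2 * E t3 * E t4 \<le> E t1 * E t2 * E t3 * \<sigma>"
      using E by (intro mult_left_mono mult_nonneg_nonneg)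
    finally show ?thesis by simp
  qed
  have "(\<Sum>t1\<in>R. \<Sum>t2\<in>R. \<Sum>t3\<in>R. K t1 * K t2 * K t3 * K (t2 + t3 - t1))
    \<le> (\<Sum>t1\<in>R. \<Sum>t2\<in>R. \<Sum>t3\<in>R. E t1 * E t2 * E t3 * \<sigma>
      + b * (E t1 * (E t2 * E (t2 + t3 - t1))) + b * (E t1 * (L t3 * E (t2 + t3 - t1)))
      + b * (L t2 * (L t3 * E (t2 + t3 - t1))) + b * (L t1 * (L t2 * L t3)))"
    by (intro sum_mono le)
  also have "\<dots> = (\<Sum>t1\<in>R. \<Sum>t2\<in>R. \<Sum>t3\<in>R. E t1 * E t2 * E t3 * \<sigma>)
      + b * (\<Sum>t1\<in>R. \<Sum>t2\<in>R. \<Sum>t3\<in>R. E t1 * (E t2 * E (t2 + t3 - t1)))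
      + b * (\<Sum>t1\<in>R. \<Sum>t2\<in>R. \<Sum>t3\<in>R. E t1 * (L t3 * E (t2 + t3 - t1)))
      + b * (\<Sum>t1\<in>R. \<Sum>t2\<in>R. \<Sum>t3\<in>R. L t2 * (L t3 * E (t2 + t3 - t1)))
      + b * (\<Sum>t1\<in>R. \<Sum>t2\<in>R. \<Sum>t3\<in>R. L t1 * (L t2 * L t3))"
    by (simp only: sum.distrib sum_distrib_left[symmetric])
  also have "(\<Sum>t1\<in>R. \<Sum>t2\<in>R. \<Sum>t3\<in>R. E t1 * E t2 * E t3 * \<sigma>) = \<sigma> * m ^ 3"
    by (simp only: sum_distrib_left[symmetric] sum_distrib_right[symmetric] m' power3_eq_cube mult_ac)
  also have "(\<Sum>t1\<in>R. \<Sum>t2\<in>R. \<Sum>t3\<in>R. E t1 * (E t2 * E (t2 + t3 - t1))) = m ^ 3"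
    by (simp only: sum_distrib_left[symmetric] sum_distrib_right[symmetric] m' shift3 power3_eq_cube mult_ac)
  also have "(\<Sum>t1\<in>R. \<Sum>t2\<in>R. \<Sum>t3\<in>R. E t1 * (L t3 * E (t2 + t3 - t1))) = m ^ 2 * (m + P * b)"
  \<comment> \<open>The variable \<open>t2\<close> now occurs only in the last factor, so its sum is
    moved inside and evaluated by a shift.\<close>
  proof -
    have "(\<Sum>t1\<in>R. \<Sum>t2\<in>R. \<Sum>t3\<in>R. E t1 * (L t3 * E (t2 + t3 - t1)))
      = (\<Sum>t1\<in>R. \<Sum>t3\<in>R. \<Sum>t2\<in>R. E t1 * (L t3 * E (t2 + t3 - t1)))"
      by (intro sum.cong refl sum.swap)
    then show ?thesis
      by (simp only: sum_distrib_left[symmetric] sum_distrib_right[symmetric] m' L shift2 power2_eq_square mult_ac)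
  qed
  also have "(\<Sum>t1\<in>R. \<Sum>t2\<in>R. \<Sum>t3\<in>R. L t2 * (L t3 * E (t2 + t3 - t1))) = m * (m + P * b) ^ 2"
  proof -
    have "(\<Sum>t1\<in>R. \<Sum>t2\<in>R. \<Sum>t3\<in>R. L t2 * (L t3 * E (t2 + t3 - t1)))
      = (\<Sum>t2\<in>R. \<Sum>t1\<in>R. \<Sum>t3\<in>R. L t2 * (L t3 * E (t2 + t3 - t1)))"
      by (rule sum.swap)
    also have "\<dots> = (\<Sum>t2\<in>R. \<Sum>t3\<in>R. \<Sum>t1\<in>R. L t2 * (L t3 * E (t2 + t3 - t1)))"
      by (intro sum.cong refl sum.swap)
    finally show ?thesis
      by (simp only: sum_distrib_left[symmetric] sum_distrib_right[symmetric] L shift1 power2_eq_square mult_ac)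
  qed
  also have "(\<Sum>t1\<in>R. \<Sum>t2\<in>R. \<Sum>t3\<in>R. L t1 * (L t2 * L t3)) = (m + P * b) ^ 3"
    by (simp only: sum_distrib_left[symmetric] sum_distrib_right[symmetric] L power3_eq_cube mult_ac)
  finally show ?thesis by (simp add: R_def algebra_simps)
qed

lemma sum_residues_dvd:
  fixes a :: real and p s :: int
  assumes "p > 0"
  shows "(\<Sum>t\<in>{0..<p}. if p dvd s + t then a else 0) = a"
proof -
  have "(\<Sum>t\<in>{0..<p}. if p dvd t then a else 0) = (\<Sum>t\<in>{0..<p}. if t = 0 then a else 0)"
    by (intro sum.cong refl) (auto dest: zdvd_imp_le)
  also have "\<dots> = a" using assms by simp
  finally show ?thesis
    using sum_residues_shift[OF assms mod_invariant_dvd[of p p a 0], of s]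
    by (simp add: add.commute)
qed

text \<open>The slice \<open>s = 0\<close> of the cube sum carries the main term \<open>1\<close> (all frequencies zero); the
  generic slices account for cubes with at least four nonzero frequencies.\<close>

lemma cube_sum_prime_le:
  fixes u :: real
  assumes p: "prime p" and u: "u \<ge> 0" "p * u \<ge> 1" "p * u\<^sup>2 \<le> 4"
  shows "cube_sum p (\<lambda>x. if p dvd x then 1 else u) \<le> 1 + 156 * u\<^sup>2 + 8 * p * u ^ 4 + 108 * p ^ 4 * u ^ 8"
proof -
  have pos: "p > 0" using p by (simp add: prime_gt_0_int)
  define W where "W = (\<lambda>x. if p dvd x then 1 else u)"
  define N where "N = (\<lambda>s. \<Sum>t1\<in>{0..<p}. \<Sum>t2\<in>{0..<p}. \<Sum>t3\<in>{0..<p}. cube_weight W s t1 t2 t3)"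
  have N_eq: "N s = (\<Sum>t1\<in>{0..<p}. \<Sum>t2\<in>{0..<p}. \<Sum>t3\<in>{0..<p}.
    (W t1 * W (s + t1)) * (W t2 * W (s + t2)) * (W t3 * W (s + t3)) *
     (W (t2 + t3 - t1) * W (s + (t2 + t3 - t1))))" for s
    by (simp add: N_def cube_weight_def)
  have W0: "0 \<le> W t * W (s + t)" for s t
    using u by (auto simp: W_def)
  have 1: "N 0 \<le> 1 + 156 * u\<^sup>2"
  proof -
    have "N 0 \<le> 1 * 1 ^ 3 + u\<^sup>2 * (1 ^ 3 + 1 ^ 2 * (1 + p * u\<^sup>2) + 1 * (1 + p * u\<^sup>2) ^ 2 + (1 + p * u\<^sup>2) ^ 3)"
      unfolding N_eq
    proof (rule additive_energy_le[OF pos, where E = "\<lambda>t. if p dvd t then 1 else 0"])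
      show "(\<Sum>t\<in>{0..<p}. if p dvd t then 1 else 0) = (1::real)"
        using sum_residues_dvd[OF pos, of 0] by simp
      show "W t * W (0 + t) \<le> (if p dvd t then 1 else 0) + u\<^sup>2" for t
        by (auto simp: W_def power2_eq_square)
    qed (use W0[of _ 0] in \<open>auto intro: mod_invariant_dvd\<close>)
    \<comment> \<open>From \<open>p * u\<^sup>2 \<le> 4\<close> the total mass
      \<open>1 + p * u\<^sup>2\<close> is at most 5, and 1 + 5 + 25 + 125 = 156.\<close>
    also have "\<dots> \<le> 1 * 1 ^ 3 + u\<^sup>2 * (1 ^ 3 + 1 ^ 2 * 5 + 1 * 5 ^ 2 + 5 ^ 3)"
      using u pos by (intro add_mono mult_left_mono power_mono order_refl) auto
    finally show ?thesis by simp
  qed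
  have 2: "N s \<le> 8 * u ^ 4 + 108 * p ^ 3 * u ^ 8" if s: "s \<in> {0..<p} - {0}" for s
  proof -
    \<comment> \<open>For \<open>s\<close> nonzero modulo \<open>p\<close>, at most one of
      \<open>t\<close> and \<open>s + t\<close> is a multiple of \<open>p\<close>. Hence the edge
      weight is \<open>u\<close> on two residue classes and \<open>u\<^sup>2\<close> elsewhere;
      \<open>E\<close> collects the two classes, with supremum \<open>u\<close> and mass
      \<open>2 * u\<close>.\<close>
    define E where "E = (\<lambda>t. (if p dvd t then u else 0) + (if p dvd s + t then u else 0))"
    have ns: "\<not> p dvd s" using s by (auto dest: zdvd_imp_le)
    then have nboth: "\<not> (p dvd t \<and> p dvd s + t)" for t
      using dvd_add_left_iff by blast
    have inv: "mod_invariant p E"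
      unfolding E_def mod_invariant_def
    proof (intro allI impI)
      fix x y assume xy: "x mod p = y mod p"
      then have "(s + x) mod p = (s + y) mod p" by (rule mod_add_cong[OF refl])
      with xy have "p dvd x \<longleftrightarrow> p dvd y" "p dvd s + x \<longleftrightarrow> p dvd s + y"
        by (auto simp: dvd_eq_mod_eq_0)
      then show "(if p dvd x then u else 0) + (if p dvd s + x then u else 0) =
        (if p dvd y then u else 0) + (if p dvd s + y then u else 0)" by simp
    qed
    define Y where "Y = 2 * u + p * u\<^sup>2"
    have "N s \<le> u * (2 * u) ^ 3 + u\<^sup>2 * ((2 * u) ^ 3 + (2 * u) ^ 2 * Y + (2 * u) * Y ^ 2 + Y ^ 3)"
      unfolding N_eq Y_def
    proof (rule additive_energy_le[OF pos inv])
      show "(\<Sum>t\<in>{0..<p}. E t) = 2 * u"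
        using sum_residues_dvd[OF pos, of 0 u] sum_residues_dvd[OF pos, of s u]
        by (simp add: E_def sum.distrib)
      show "0 \<le> E t" "E t \<le> u" for t
        using nboth[of t] u by (auto simp: E_def)
      show "W t * W (s + t) \<le> E t + u\<^sup>2" for t
        using nboth[of t] u by (auto simp: E_def W_def power2_eq_square)
    qed (use W0 in auto)
    \<comment> \<open>Since \<open>p * u \<ge> 1\<close>, both \<open>2 * u\<close> and
      \<open>Y\<close> are at most \<open>3 * p * u\<^sup>2\<close>. The four terms then become
      equal cubes, and 4 * 27 = 108.\<close>
    also have "\<dots> \<le> u * (2 * u) ^ 3 + u\<^sup>2 * (Z ^ 3 + Z ^ 2 * Z + Z * Z ^ 2 + Z ^ 3)" if "Z = 3 * p * u\<^sup>2" for Z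
    proof -
      have "u \<le> p * u\<^sup>2"
        using mult_right_mono[OF u(2) u(1)] by (simp add: power2_eq_square)
      then have "2 * u \<le> Z" "Y \<le> Z" "0 \<le> Y" "0 \<le> Z"
        using u pos that by (auto simp: Y_def)
      moreover have "0 \<le> 2 * u" using u by simp
      ultimately show ?thesis
        by (intro add_mono mult_left_mono mult_mono power_mono order_refl zero_le_power zero_le_power2)
    qed
    also have "u * (2 * u) ^ 3 + u\<^sup>2 * ((3 * p * u\<^sup>2) ^ 3 + (3 * p * u\<^sup>2) ^ 2 * (3 * p * u\<^sup>2)
      + (3 * p * u\<^sup>2) * (3 * p * u\<^sup>2) ^ 2 + (3 * p * u\<^sup>2) ^ 3) = 8 * u ^ 4 + 108 * p ^ 3 * u ^ 8"
      by (simp add: power_mult_distrib algebra_simps eval_nat_numeral)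
    finally show ?thesis by simp
  qed
  have "cube_sum p W = (\<Sum>s\<in>{0..<p}. N s)"
    by (simp add: cube_sum_def N_def)
  also have "\<dots> = N 0 + (\<Sum>s\<in>{0..<p} - {0}. N s)"
    using pos by (simp add: sum.remove)
  also have "\<dots> \<le> (1 + 156 * u\<^sup>2) + (\<Sum>s\<in>{0..<p} - {0}. 8 * u ^ 4 + 108 * p ^ 3 * u ^ 8)"
    by (intro add_mono 1 sum_mono 2)
  also have "\<dots> \<le> (1 + 156 * u\<^sup>2) + p * (8 * u ^ 4 + 108 * p ^ 3 * u ^ 8)"
    using pos by (simp add: mult_right_mono)
  also have "\<dots> = 1 + 156 * u\<^sup>2 + 8 * p * u ^ 4 + 108 * p ^ 4 * u ^ 8"
    by (simp add: algebra_simps eval_nat_numeral)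
  finally show ?thesis by (simp add: W_def)
qed

text \<open>The cube sum factors over the primes, each factor is 1 plus a summable error, and so the
  product is bounded independently of the set of primes.\<close>

lemma cube_sum_primes_bounded:
  fixes \<delta> :: real
  assumes \<delta>: "0 < \<delta>" "\<delta> \<le> 1 / 24"
  shows "\<exists>C>0. \<forall>A. finite A \<longrightarrow> (\<forall>p\<in>A. prime p) \<longrightarrow>
    cube_sum (\<Prod>A) (local_weight (\<lambda>p. p powr (3 / 8 - \<delta>) / (p - 1)) A) \<le> C"
proof (intro exI conjI allI impI)
  define u where "u = (\<lambda>p::int. p powr (3 / 8 - \<delta>) / (p - 1))"
  define S where "S = (\<Sum>n. real n powr (-1 - 8 * \<delta>))"
  have summable: "summable (\<lambda>n. real n powr (-1 - 8 * \<delta>))"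
    using \<delta> by (simp add: summable_real_powr_iff)
  \<comment> \<open>The constant is 156 * 4 + 8 * 16 + 108 * 256: the coefficients of
    \<open>cube_sum_prime_le\<close> times the factor \<open>2 ^ k\<close> lost in bounding
    \<open>u p ^ k\<close>.\<close>
  show "0 < exp (28400 * S)" by simp
  fix A :: "int set" assume A: "finite A" "\<forall>p\<in>A. prime p"
  have local: "cube_sum p (\<lambda>x. if p dvd x then 1 else u p) \<le> 1 + 28400 * p powr (-1 - 8 * \<delta>)"
    if "prime p" for p
  proof -
    have p: "real_of_int p \<ge> 2" using prime_ge_2_int[OF that] by simp
    have u0: "0 \<le> u p" using p by (simp add: u_def)
    \<comment> \<open>For \<open>p \<ge> 2\<close> the denominator \<open>p - 1\<close> is at least
      \<open>p / 2\<close>, which is the source of the factor 2.\<close>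
    have "p powr (3 / 8 - \<delta>) / (p - 1) \<le> p powr (3 / 8 - \<delta>) / (p / 2)"
      using p by (intro divide_left_mono) auto
    also have "\<dots> = 2 * p powr (- 5 / 8 - \<delta>)"
      using p powr_diff[of "real_of_int p" "3 / 8 - \<delta>" 1] by simp
    finally have u: "u p \<le> 2 * p powr (- 5 / 8 - \<delta>)" by (simp add: u_def)
    have u_pow: "u p ^ k \<le> 2 ^ k * p powr (k * (- 5 / 8 - \<delta>))" for k
    proof -
      have "u p ^ k \<le> (2 * p powr (- 5 / 8 - \<delta>)) ^ k" by (intro power_mono u u0)
      also have "\<dots> = 2 ^ k * p powr (k * (- 5 / 8 - \<delta>))"
        using p by (simp add: power_mult_distrib powr_power mult.commute)
      finally show ?thesis .
    qed
    have pu_pow: "p ^ j * u p ^ k \<le> 2 ^ k * p powr b" if "j + k * (- 5 / 8 - \<delta>) \<le> b" for j k b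
    proof -
      have "p ^ j * u p ^ k \<le> p ^ j * (2 ^ k * p powr (k * (- 5 / 8 - \<delta>)))"
        using p by (intro mult_left_mono u_pow) auto
      also have "\<dots> = 2 ^ k * p powr (j + k * (- 5 / 8 - \<delta>))"
        using p by (simp add: powr_add powr_realpow)
      also have "\<dots> \<le> 2 ^ k * p powr b"
        using p that by (intro mult_left_mono powr_mono) auto
      finally show ?thesis .
    qed
    have "1 \<le> p * u p"
    proof -
      have "1 * 1 \<le> p powr (3 / 8 - \<delta>) * (p / (p - 1))"
        using p \<delta> by (intro mult_mono ge_one_powr_ge_zero) auto
      then show ?thesis by (simp add: u_def field_simps)
    qed
    moreover have "p * (u p)\<^sup>2 \<le> 4"
      using pu_pow[of 1 2 0] \<delta> p by simp
    ultimately have "cube_sum p (\<lambda>x. if p dvd x then 1 else u p) \<le>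
      1 + 156 * (u p)\<^sup>2 + 8 * p * u p ^ 4 + 108 * p ^ 4 * u p ^ 8"
      using cube_sum_prime_le[OF that u0] by simp
    \<comment> \<open>The exponent is -5/4 - 2\<delta>, and it is at most -1 - 8\<delta> exactly
      when \<delta> \<le> 1/24.\<close>
    moreover have "(u p)\<^sup>2 \<le> 4 * p powr (-1 - 8 * \<delta>)"
      using pu_pow[of 0 2 "-1 - 8 * \<delta>"] \<delta> by simp
    moreover have "p * u p ^ 4 \<le> 16 * p powr (-1 - 8 * \<delta>)"
      using pu_pow[of 1 4 "-1 - 8 * \<delta>"] \<delta> by simp
    \<comment> \<open>Here the exponent 4 + 8(-5/8 - \<delta>) equals -1 - 8\<delta>. This generic
      contribution, \<open>p ^ 4\<close> cubes of weight \<open>u p ^ 8\<close>, is critical: it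
      forces the Rankin exponent to stay below 3/8.\<close>
    moreover have "p ^ 4 * u p ^ 8 \<le> 256 * p powr (-1 - 8 * \<delta>)"
      using pu_pow[of 4 8 "-1 - 8 * \<delta>"] \<delta> by simp
    ultimately show ?thesis by simp
  qed
  have "cube_sum (\<Prod>A) (local_weight u A) = (\<Prod>p\<in>A. cube_sum p (\<lambda>x. if p dvd x then 1 else u p))"
    using A by (intro cube_sum_local_weight) auto
  \<comment> \<open>The inequality 1 + x \<le> exp x turns the product into the exponential of a
    convergent sum over primes.\<close>
  also have "\<dots> \<le> (\<Prod>p\<in>A. exp (28400 * p powr (-1 - 8 * \<delta>)))"
  proof (intro prod_mono conjI)
    fix p assume "p \<in> A"
    then have "prime p" using A(2) by blast
    then have "u p \<ge> 0" using prime_ge_2_int[of p] by (simp add: u_def)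
    then show "0 \<le> cube_sum p (\<lambda>x. if p dvd x then 1 else u p)"
      by (intro cube_sum_nonneg) auto
    show "cube_sum p (\<lambda>x. if p dvd x then 1 else u p) \<le> exp (28400 * p powr (-1 - 8 * \<delta>))"
      using local[OF \<open>prime p\<close>] exp_ge_add_one_self order_trans by blast
  qed
  also have "\<dots> = exp (28400 * (\<Sum>p\<in>A. p powr (-1 - 8 * \<delta>)))"
    by (simp add: exp_sum A(1) sum_distrib_left)
  also have "(\<Sum>p\<in>A. p powr (-1 - 8 * \<delta>)) = (\<Sum>n\<in>nat ` A. real n powr (-1 - 8 * \<delta>))"
    using A(2) by (subst sum.reindex) (auto intro!: inj_onI sum.cong simp: prime_ge_0_int eq_nat_nat_iff)
  also have "\<dots> \<le> S"
    unfolding S_def using A(1) by (intro sum_le_suminf summable) auto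
  finally show "cube_sum (\<Prod>A) (local_weight (\<lambda>p. p powr (3 / 8 - \<delta>) / (p - 1)) A) \<le> exp (28400 * S)"
    by (simp add: u_def)
qed

section \<open>Exponential sums over cubes\<close>

lemma e_eq_cis: "e t = cis (2 * pi * t)"
  by (simp add: e_def cis_conv_exp mult_ac)

lemma e_add: "e (s + t) = e s * e t"
  by (simp add: e_eq_cis cis_mult distrib_left)

lemma cnj_e: "cnj (e t) = e (- t)"
  by (simp add: e_eq_cis cis_cnj)

lemma norm_e [simp]: "norm (e t) = 1"
  by (simp add: e_eq_cis)

lemma e_power: "e t ^ n = e (n * t)"
  by (simp only: e_eq_cis Complex.DeMoivre mult_ac)

lemma e_eq_1_iff: "e t = 1 \<longleftrightarrow> t \<in> \<int>"
proof -
  have "e t = 1 \<longleftrightarrow> (\<exists>n::int. 2 * pi * t = of_int (2 * n) * pi)"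
    by (simp add: e_eq_cis cis_conv_exp exp_eq_1)
  also have "\<dots> \<longleftrightarrow> (\<exists>n::int. t = of_int n)"
    by (simp add: field_simps)
  finally show ?thesis by (auto elim: Ints_cases)
qed

text \<open>Complete periods of length \<open>D\<close> sum to zero, so only an incomplete block of
  fewer than \<open>D\<close> unimodular terms survives.\<close>

lemma norm_sum_powers_le:
  fixes z :: complex
  assumes "z ^ D = 1" "z \<noteq> 1" "D > 0" "norm z = 1"
  shows "norm (\<Sum>k<n. z ^ k) \<le> D"
proof -
  have "z ^ n = (z ^ D) ^ (n div D) * z ^ (n mod D)"
    by (simp flip: power_mult power_add)
  then have "(\<Sum>k<n. z ^ k) = (\<Sum>k<n mod D. z ^ k)"
    using assms by (simp add: geometric_sum)
  also have "norm \<dots> \<le> (\<Sum>k<n mod D. 1)"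
    by (rule sum_norm_le) (simp add: norm_power assms)
  also have "\<dots> \<le> D" using assms(3) by (simp add: less_imp_le)
  finally show ?thesis .
qed

lemma norm_sum_e_le:
  fixes l u :: int and \<theta> :: real
  assumes "D > 0" "real D * \<theta> \<in> \<int>" "\<theta> \<notin> \<int>"
  shows "norm (\<Sum>v\<in>{l..u}. e (\<theta> * v)) \<le> D"
proof -
  have "(\<Sum>v\<in>{l..u}. e (\<theta> * v)) = (\<Sum>k<nat (u - l + 1). e (\<theta> * (l + int k)))"
    by (rule sum.reindex_bij_witness[where i = "\<lambda>k. l + int k" and j = "\<lambda>v. nat (v - l)"]) auto
  also have "\<dots> = e (\<theta> * l) * (\<Sum>k<nat (u - l + 1). e \<theta> ^ k)"
    by (simp add: sum_distrib_left e_power distrib_left e_add mult.commute)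
  also have "norm \<dots> \<le> D"
    using norm_sum_powers_le[of "e \<theta>" D "nat (u - l + 1)"] assms
    by (simp add: norm_mult e_power e_eq_1_iff)
  finally show ?thesis .
qed

text \<open>This lets one-variable fibres of a convex region be summed as geometric progressions
  without computing their endpoints.\<close>

lemma int_convex_imp_interval:
  fixes S :: "int set"
  assumes "finite S" "\<And>a b v. a \<in> S \<Longrightarrow> b \<in> S \<Longrightarrow> a \<le> v \<Longrightarrow> v \<le> b \<Longrightarrow> v \<in> S"
  obtains l u where "S = {l..u}"
proof (cases "S = {}")
  case True
  then show ?thesis using that[of 1 0] by simp
next
  case False
  have "S = {Min S..Max S}"
  proof (intro equalityI subsetI)
    show "v \<in> {Min S..Max S}" if "v \<in> S" for v
      using that assms(1) by simp
    show "v \<in> S" if "v \<in> {Min S..Max S}" for v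
      using that by (intro assms(2)[OF Min_in[OF assms(1) False] Max_in[OF assms(1) False]]) simp_all
  qed
  then show ?thesis by (rule that)
qed

text \<open>Summation along one coordinate, stated abstractly so that it serves all four variables
  of a cube: \<open>c\<close> is the chosen coordinate, \<pi> forgets it, and \<open>ins\<close>
  puts it back. Over each \<open>y\<close> the coordinate runs through an interval while
  \<open>w y\<close>, the phase of the other variables, is constant, so the fibre contributes at
  most \<open>D\<close>.\<close>

lemma norm_sum_e_fibres_le:
  fixes \<theta> :: real
  assumes D: "D > 0" "real D * \<theta> \<in> \<int>" "\<theta> \<notin> \<int>"
    and fin: "finite R" "finite Y" and sub: "\<pi> ` R \<subseteq> Y"
    and ins: "\<And>v y. c (ins v y) = v" "\<And>v y. \<pi> (ins v y) = y" "\<And>r. ins (c r) (\<pi> r) = r"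
    and convex: "\<And>a b v y. ins a y \<in> R \<Longrightarrow> ins b y \<in> R \<Longrightarrow> a \<le> v \<Longrightarrow> v \<le> b \<Longrightarrow> ins v y \<in> R"
    and g: "\<And>v y. g (ins v y) = e (\<theta> * real_of_int v) * w y" and w: "\<And>y. norm (w y) \<le> 1"
  shows "norm (\<Sum>r\<in>R. g r) \<le> D * card Y"
proof -
  have "norm (\<Sum>r\<in>{r \<in> R. \<pi> r = y}. g r) \<le> D" for y
  proof -
    let ?F = "{v. ins v y \<in> R}"
    have ins_y: "ins (c r) y = r" if "\<pi> r = y" for r
      using ins(3)[of r] that by (simp only:)
    have g_y: "e (\<theta> * real_of_int (c r)) * w y = g r" if "\<pi> r = y" for r
      using g[of "c r" y] ins_y[OF that] by simp
    have F: "?F = c ` {r \<in> R. \<pi> r = y}"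
    proof (intro set_eqI iffI)
      fix v assume "v \<in> ?F"
      then show "v \<in> c ` {r \<in> R. \<pi> r = y}"
        by (intro image_eqI[of _ _ "ins v y"]) (simp_all add: ins(1,2))
    next
      fix v assume "v \<in> c ` {r \<in> R. \<pi> r = y}"
      then obtain r where "r \<in> R" "\<pi> r = y" "v = c r" by auto
      then show "v \<in> ?F" using ins_y[of r] by simp
    qed
    have "finite ?F" unfolding F using fin by simp
    then obtain l u where lu: "?F = {l..u}"
      by (rule int_convex_imp_interval) (use convex in blast)
    have "(\<Sum>r\<in>{r \<in> R. \<pi> r = y}. g r) = (\<Sum>v\<in>?F. e (\<theta> * real_of_int v) * w y)"
      by (rule sum.reindex_bij_witness[where i = "\<lambda>v. ins v y" and j = c])
        (auto simp: ins(1,2) ins_y g_y)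
    also have "\<dots> = (\<Sum>v\<in>{l..u}. e (\<theta> * v)) * w y"
      by (simp add: lu sum_distrib_right)
    also have "norm \<dots> \<le> real D * 1"
      unfolding norm_mult by (intro mult_mono norm_sum_e_le D w) auto
    finally show ?thesis by simp
  qed
  then have "norm (\<Sum>y\<in>Y. \<Sum>r\<in>{r \<in> R. \<pi> r = y}. g r) \<le> (\<Sum>y\<in>Y. real D)"
    by (intro sum_norm_le) auto
  also have "(\<Sum>y\<in>Y. \<Sum>r\<in>{r \<in> R. \<pi> r = y}. g r) = (\<Sum>r\<in>R. g r)"
    by (rule sum.group[OF fin sub])
  finally show ?thesis by (simp add: mult.commute)
qed

section \<open>Cubes with all vertices in an interval\<close>

definition cube_region :: "int \<Rightarrow> (int \<times> int \<times> int \<times> int) set" where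
  "cube_region M = {(x, h1, h2, h3).
     {x, x + h1, x + h2, x + h1 + h2, x + h3, x + h1 + h3, x + h2 + h3, x + h1 + h2 + h3} \<subseteq> {1..M}}"

lemma cube_region_subset: "cube_region M \<subseteq> {-M..M} \<times> {-M..M} \<times> {-M..M} \<times> {-M..M}"
  by (auto simp: cube_region_def)

lemma finite_cube_region [simp]: "finite (cube_region M)"
  by (rule finite_subset[OF cube_region_subset]) simp

lemma cube_region_iff:
  "(x, h1, h2, h3) \<in> cube_region M \<longleftrightarrow>
    (\<forall>i\<in>{0, 1}. \<forall>j\<in>{0, 1}. \<forall>k\<in>{0, 1}. x + i * h1 + j * h2 + k * h3 \<in> {1..M})"
  by (auto simp: cube_region_def)

text \<open>Each vertex is an affine function of any single variable, and the constraints on the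
  vertices are intervals.\<close>

lemma cube_region_convex:
  assumes "a \<le> v" "v \<le> b"
  shows "(a, h1, h2, h3) \<in> cube_region M \<Longrightarrow> (b, h1, h2, h3) \<in> cube_region M \<Longrightarrow> (v, h1, h2, h3) \<in> cube_region M"
    and "(x, a, h2, h3) \<in> cube_region M \<Longrightarrow> (x, b, h2, h3) \<in> cube_region M \<Longrightarrow> (x, v, h2, h3) \<in> cube_region M"
    and "(x, h1, a, h3) \<in> cube_region M \<Longrightarrow> (x, h1, b, h3) \<in> cube_region M \<Longrightarrow> (x, h1, v, h3) \<in> cube_region M"
    and "(x, h1, h2, a) \<in> cube_region M \<Longrightarrow> (x, h1, h2, b) \<in> cube_region M \<Longrightarrow> (x, h1, h2, v) \<in> cube_region M"
  unfolding cube_region_iff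
proof -
  show "\<forall>i\<in>{0, 1}. \<forall>j\<in>{0, 1}. \<forall>k\<in>{0, 1}. v + i * h1 + j * h2 + k * h3 \<in> {1..M}"
    if "\<forall>i\<in>{0, 1}. \<forall>j\<in>{0, 1}. \<forall>k\<in>{0, 1}. a + i * h1 + j * h2 + k * h3 \<in> {1..M}"
      "\<forall>i\<in>{0, 1}. \<forall>j\<in>{0, 1}. \<forall>k\<in>{0, 1}. b + i * h1 + j * h2 + k * h3 \<in> {1..M}"
  proof (intro ballI)
    fix i j k :: int assume ijk: "i \<in> {0, 1}" "j \<in> {0, 1}" "k \<in> {0, 1}"
    have "a + i * h1 + j * h2 + k * h3 \<in> {1..M}" "b + i * h1 + j * h2 + k * h3 \<in> {1..M}"
      using that ijk by blast+
    then show "v + i * h1 + j * h2 + k * h3 \<in> {1..M}"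
      using ijk assms by auto
  qed
  show "\<forall>i\<in>{0, 1}. \<forall>j\<in>{0, 1}. \<forall>k\<in>{0, 1}. x + i * v + j * h2 + k * h3 \<in> {1..M}"
    if "\<forall>i\<in>{0, 1}. \<forall>j\<in>{0, 1}. \<forall>k\<in>{0, 1}. x + i * a + j * h2 + k * h3 \<in> {1..M}"
      "\<forall>i\<in>{0, 1}. \<forall>j\<in>{0, 1}. \<forall>k\<in>{0, 1}. x + i * b + j * h2 + k * h3 \<in> {1..M}"
  proof (intro ballI)
    fix i j k :: int assume ijk: "i \<in> {0, 1}" "j \<in> {0, 1}" "k \<in> {0, 1}"
    have "x + i * a + j * h2 + k * h3 \<in> {1..M}" "x + i * b + j * h2 + k * h3 \<in> {1..M}"
      using that ijk by blast+
    then show "x + i * v + j * h2 + k * h3 \<in> {1..M}"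
      using ijk assms by auto
  qed
  show "\<forall>i\<in>{0, 1}. \<forall>j\<in>{0, 1}. \<forall>k\<in>{0, 1}. x + i * h1 + j * v + k * h3 \<in> {1..M}"
    if "\<forall>i\<in>{0, 1}. \<forall>j\<in>{0, 1}. \<forall>k\<in>{0, 1}. x + i * h1 + j * a + k * h3 \<in> {1..M}"
      "\<forall>i\<in>{0, 1}. \<forall>j\<in>{0, 1}. \<forall>k\<in>{0, 1}. x + i * h1 + j * b + k * h3 \<in> {1..M}"
  proof (intro ballI)
    fix i j k :: int assume ijk: "i \<in> {0, 1}" "j \<in> {0, 1}" "k \<in> {0, 1}"
    have "x + i * h1 + j * a + k * h3 \<in> {1..M}" "x + i * h1 + j * b + k * h3 \<in> {1..M}"
      using that ijk by blast+
    then show "x + i * h1 + j * v + k * h3 \<in> {1..M}"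
      using ijk assms by auto
  qed
  show "\<forall>i\<in>{0, 1}. \<forall>j\<in>{0, 1}. \<forall>k\<in>{0, 1}. x + i * h1 + j * h2 + k * v \<in> {1..M}"
    if "\<forall>i\<in>{0, 1}. \<forall>j\<in>{0, 1}. \<forall>k\<in>{0, 1}. x + i * h1 + j * h2 + k * a \<in> {1..M}"
      "\<forall>i\<in>{0, 1}. \<forall>j\<in>{0, 1}. \<forall>k\<in>{0, 1}. x + i * h1 + j * h2 + k * b \<in> {1..M}"
  proof (intro ballI)
    fix i j k :: int assume ijk: "i \<in> {0, 1}" "j \<in> {0, 1}" "k \<in> {0, 1}"
    have "x + i * h1 + j * h2 + k * a \<in> {1..M}" "x + i * h1 + j * h2 + k * b \<in> {1..M}"
      using that ijk by blast+
    then show "x + i * h1 + j * h2 + k * v \<in> {1..M}"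
      using ijk assms by auto
  qed
qed

lemma card_cube_region_le: "M \<ge> 0 \<Longrightarrow> card (cube_region M) \<le> (2 * real_of_int M + 1) ^ 4"
proof -
  assume M: "M \<ge> 0"
  have "real (card (cube_region M)) \<le> card ({-M..M} \<times> {-M..M} \<times> {-M..M} \<times> {-M..M})"
    unfolding of_nat_le_iff by (intro card_mono cube_region_subset) simp
  also have "\<dots> = (2 * real_of_int M + 1) ^ 4"
    using M by (simp add: power4_eq_xxxx of_nat_nat algebra_simps)
  finally show ?thesis .
qed

lemma card_cube_region_ge: "M \<ge> 1 \<Longrightarrow> (real_of_int M / 4) ^ 4 \<le> card (cube_region M)"
proof -
  assume M: "M \<ge> 1"
  \<comment> \<open>This is \<open>M / 4\<close> rounded up. With \<open>x \<le> m\<close> and all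
    \<open>h\<close> in \<open>{0..<m}\<close> the farthest vertex is at most m + 3(m - 1) = 4m - 3,
    which does not exceed \<open>M\<close>.\<close>
  define m where "m = (M + 3) div 4"
  have m: "4 * m \<le> M + 3" "M \<le> 4 * m" by (auto simp: m_def)
  have "(real_of_int M / 4) ^ 4 \<le> real_of_int m ^ 4"
    using m M by (intro power_mono) auto
  also have "\<dots> = card ({1..m} \<times> {0..<m} \<times> {0..<m} \<times> {0..<m})"
    using m M by (simp add: power4_eq_xxxx of_nat_nat)
  also have "{1..m} \<times> {0..<m} \<times> {0..<m} \<times> {0..<m} \<subseteq> cube_region M"
    using m by (auto simp: cube_region_def)
  then have "real (card ({1..m} \<times> {0..<m} \<times> {0..<m} \<times> {0..<m})) \<le> card (cube_region M)"
    unfolding of_nat_le_iff by (intro card_mono) simp_all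
  finally show ?thesis .
qed

text \<open>Some variable has a non-integral coefficient with denominator dividing \<open>D\<close>.
  Summing over it first saves a full variable: the other three range over a box with sides of length
  \<open>2 * M + 1\<close>.\<close>

lemma norm_sum_cube_region_le:
  fixes \<alpha> \<beta>1 \<beta>2 \<beta>3 :: real
  assumes D: "D > 0" "real D * \<alpha> \<in> \<int>" "real D * \<beta>1 \<in> \<int>" "real D * \<beta>2 \<in> \<int>" "real D * \<beta>3 \<in> \<int>"
    and nonres: "\<not> (\<alpha> \<in> \<int> \<and> \<beta>1 \<in> \<int> \<and> \<beta>2 \<in> \<int> \<and> \<beta>3 \<in> \<int>)" and M: "M \<ge> 0"
  shows "norm (\<Sum>(x, h1, h2, h3)\<in>cube_region M. e (\<alpha> * x + \<beta>1 * h1 + \<beta>2 * h2 + \<beta>3 * h3))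
    \<le> D * (2 * real_of_int M + 1) ^ 3"
proof -
  let ?g = "\<lambda>(x :: int, h1 :: int, h2 :: int, h3 :: int). e (\<alpha> * x + \<beta>1 * h1 + \<beta>2 * h2 + \<beta>3 * h3)"
  let ?Y = "{-M..M} \<times> {-M..M} \<times> {-M..M}"
  have card: "real (card ?Y) = (2 * real_of_int M + 1) ^ 3"
    using M by (simp add: power3_eq_cube of_nat_nat algebra_simps)
  consider "\<alpha> \<notin> \<int>" | "\<beta>1 \<notin> \<int>" | "\<beta>2 \<notin> \<int>" | "\<beta>3 \<notin> \<int>" using nonres by blast
  then have "norm (\<Sum>r\<in>cube_region M. ?g r) \<le> D * card ?Y"
  proof cases
    case 1
    show ?thesis
      by (rule norm_sum_e_fibres_le[OF D(1,2) 1, where \<pi> = "\<lambda>(x, h1, h2, h3). (h1, h2, h3)"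
            and c = "\<lambda>(x, h1, h2, h3). x" and ins = "\<lambda>x (h1, h2, h3). (x, h1, h2, h3)"
            and w = "\<lambda>(h1 :: int, h2 :: int, h3 :: int). e (\<beta>1 * h1 + \<beta>2 * h2 + \<beta>3 * h3)"])
        (auto simp: e_add[symmetric] add_ac dest: subsetD[OF cube_region_subset] intro: cube_region_convex(1))
  next
    case 2
    show ?thesis
      by (rule norm_sum_e_fibres_le[OF D(1,3) 2, where \<pi> = "\<lambda>(x, h1, h2, h3). (x, h2, h3)"
            and c = "\<lambda>(x, h1, h2, h3). h1" and ins = "\<lambda>h1 (x, h2, h3). (x, h1, h2, h3)"
            and w = "\<lambda>(x :: int, h2 :: int, h3 :: int). e (\<alpha> * x + \<beta>2 * h2 + \<beta>3 * h3)"])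
        (auto simp: e_add[symmetric] add_ac dest: subsetD[OF cube_region_subset] intro: cube_region_convex(2))
  next
    case 3
    show ?thesis
      by (rule norm_sum_e_fibres_le[OF D(1,4) 3, where \<pi> = "\<lambda>(x, h1, h2, h3). (x, h1, h3)"
            and c = "\<lambda>(x, h1, h2, h3). h2" and ins = "\<lambda>h2 (x, h1, h3). (x, h1, h2, h3)"
            and w = "\<lambda>(x :: int, h1 :: int, h3 :: int). e (\<alpha> * x + \<beta>1 * h1 + \<beta>3 * h3)"])
        (auto simp: e_add[symmetric] add_ac dest: subsetD[OF cube_region_subset] intro: cube_region_convex(3))
  next
    case 4
    show ?thesis
      by (rule norm_sum_e_fibres_le[OF D(1,5) 4, where \<pi> = "\<lambda>(x, h1, h2, h3). (x, h1, h2)"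
            and c = "\<lambda>(x, h1, h2, h3). h3" and ins = "\<lambda>h3 (x, h1, h2). (x, h1, h2, h3)"
            and w = "\<lambda>(x :: int, h1 :: int, h2 :: int). e (\<alpha> * x + \<beta>1 * h1 + \<beta>2 * h2)"])
        (auto simp: e_add[symmetric] add_ac dest: subsetD[OF cube_region_subset] intro: cube_region_convex(4))
  qed
  then show ?thesis by (simp only: card of_nat_mult)
qed

section \<open>Expansion into frequencies\<close>

text \<open>The eight factors are grouped into the four edges in direction \<open>h1\<close>, which
  is why frequencies are later indexed by four pairs.\<close>

lemma mult_derivs_three:
  "mult_derivs [h1, h2, h3] f x = mult_deriv h1 f x * cnj (mult_deriv h1 f (x + h2)) *
    cnj (mult_deriv h1 f (x + h3)) * mult_deriv h1 f (x + h2 + h3)"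
  by (simp add: mult_derivs_def mult_deriv_def[of h2] mult_deriv_def[of h3] add_ac mult_ac)

lemma mult_derivs_indicator:
  "mult_derivs [h1, h2, h3] (\<lambda>n. f n * indicator {1..M} n) x =
    (if (x, h1, h2, h3) \<in> cube_region M then mult_derivs [h1, h2, h3] f x else 0)"
  by (auto simp: mult_derivs_def mult_deriv_def cube_region_def indicator_def add_ac)

lemma infsum_mult_derivs_indicator:
  "(\<Sum>\<^sub>\<infinity>(x, h1, h2, h3)\<in>UNIV. mult_derivs [h1, h2, h3] (\<lambda>n. f n * indicator {1..M} n) x) =
    (\<Sum>(x, h1, h2, h3)\<in>cube_region M. mult_derivs [h1, h2, h3] f x)"
proof -
  have "(\<Sum>\<^sub>\<infinity>(x, h1, h2, h3)\<in>UNIV. mult_derivs [h1, h2, h3] (\<lambda>n. f n * indicator {1..M} n) x) =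
    (\<Sum>\<^sub>\<infinity>(x, h1, h2, h3)\<in>cube_region M. mult_derivs [h1, h2, h3] f x)"
    unfolding mult_derivs_indicator by (rule infsum_cong_neutral) (auto split: prod.splits)
  then show ?thesis by simp
qed

text \<open>The normalizing norm is the same sum for the constant function 1, which simply counts
  the cubes in the interval.\<close>

lemma U3_norm_interval_eq:
  "U3_norm_interval M f =
    root 8 (Re (\<Sum>(x, h1, h2, h3)\<in>cube_region M. mult_derivs [h1, h2, h3] f x) / card (cube_region M))"
proof -
  have "U3_norm (indicator {1..M}) = root 8 (card (cube_region M))"
  proof -
    have "mult_derivs [h1, h2, h3] (\<lambda>n. 1) x = 1" for h1 h2 h3 x
      by (simp add: mult_derivs_def mult_deriv_def)
    then show ?thesis
      using infsum_mult_derivs_indicator[of "\<lambda>n. 1" M] by (simp add: U3_norm_def split_beta)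
  qed
  then show ?thesis
    by (simp add: U3_norm_interval_def U3_norm_def infsum_mult_derivs_indicator real_root_divide)
qed

section \<open>Eight-tuples of frequencies and their phases\<close>

definition cube_freqs :: "'j set \<Rightarrow> (('j \<times> 'j) \<times> ('j \<times> 'j) \<times> ('j \<times> 'j) \<times> ('j \<times> 'j)) set" where
  "cube_freqs J = (J \<times> J) \<times> (J \<times> J) \<times> (J \<times> J) \<times> (J \<times> J)"

text \<open>The value type is left general: real coefficients give the coefficient of a term of the
  expansion, natural denominators give a common denominator of its phases.\<close>

definition cube_coeff :: "('j \<Rightarrow> 'a::comm_monoid_mult) \<Rightarrow> (('j \<times> 'j) \<times> ('j \<times> 'j) \<times> ('j \<times> 'j) \<times> ('j \<times> 'j)) \<Rightarrow> 'a" where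
  "cube_coeff c = (\<lambda>((i1, j1), (i2, j2), (i3, j3), (i4, j4)).
     (c i1 * c j1) * (c i2 * c j2) * (c i3 * c j3) * (c i4 * c j4))"

text \<open>The coefficients of \<open>x\<close>, \<open>h\<^sub>1\<close>, \<open>h\<^sub>2\<close>, \<open>h\<^sub>3\<close> in the phase of the term of
  \<open>mult_derivs [h1, h2, h3] f x\<close> with frequencies \<open>k\<close>; edge \<open>r\<close> is parallel to \<open>h\<^sub>1\<close> and has
  frequency \<open>\<theta> i\<^sub>r\<close> at one end and \<open>\<theta> j\<^sub>r\<close> at the other.\<close>

definition phase_x :: "('j \<Rightarrow> 'a::ab_group_add) \<Rightarrow> (('j \<times> 'j) \<times> ('j \<times> 'j) \<times> ('j \<times> 'j) \<times> ('j \<times> 'j)) \<Rightarrow> 'a" where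
  "phase_x \<theta> = (\<lambda>((i1, j1), (i2, j2), (i3, j3), (i4, j4)).
     - (\<theta> i1 - \<theta> j1) + (\<theta> i2 - \<theta> j2) + (\<theta> i3 - \<theta> j3) - (\<theta> i4 - \<theta> j4))"

definition phase_h1 :: "('j \<Rightarrow> 'a::ab_group_add) \<Rightarrow> (('j \<times> 'j) \<times> ('j \<times> 'j) \<times> ('j \<times> 'j) \<times> ('j \<times> 'j)) \<Rightarrow> 'a" where
  "phase_h1 \<theta> = (\<lambda>((i1, j1), (i2, j2), (i3, j3), (i4, j4)). \<theta> j1 - \<theta> j2 - \<theta> j3 + \<theta> j4)"

definition phase_h2 :: "('j \<Rightarrow> 'a::ab_group_add) \<Rightarrow> (('j \<times> 'j) \<times> ('j \<times> 'j) \<times> ('j \<times> 'j) \<times> ('j \<times> 'j)) \<Rightarrow> 'a" where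
  "phase_h2 \<theta> = (\<lambda>((i1, j1), (i2, j2), (i3, j3), (i4, j4)). (\<theta> i2 - \<theta> j2) - (\<theta> i4 - \<theta> j4))"

definition phase_h3 :: "('j \<Rightarrow> 'a::ab_group_add) \<Rightarrow> (('j \<times> 'j) \<times> ('j \<times> 'j) \<times> ('j \<times> 'j) \<times> ('j \<times> 'j)) \<Rightarrow> 'a" where
  "phase_h3 \<theta> = (\<lambda>((i1, j1), (i2, j2), (i3, j3), (i4, j4)). (\<theta> i3 - \<theta> j3) - (\<theta> i4 - \<theta> j4))"

lemmas phase_defs = phase_x_def phase_h1_def phase_h2_def phase_h3_def

definition resonant :: "('j \<Rightarrow> real) \<Rightarrow> (('j \<times> 'j) \<times> ('j \<times> 'j) \<times> ('j \<times> 'j) \<times> ('j \<times> 'j)) \<Rightarrow> bool" where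
  "resonant \<theta> k \<longleftrightarrow> phase_x \<theta> k \<in> \<int> \<and> phase_h1 \<theta> k \<in> \<int> \<and> phase_h2 \<theta> k \<in> \<int> \<and> phase_h3 \<theta> k \<in> \<int>"

lemma sum_product_pairs:
  fixes f :: "'k \<Rightarrow> 'a::semiring_0" and g :: "'l \<Rightarrow> 'a"
  shows "sum f A * sum g B = (\<Sum>p\<in>A \<times> B. f (fst p) * g (snd p))"
  by (simp add: sum_product sum.cartesian_product split_beta)

lemma sum_product4:
  fixes a b c d :: "'k \<Rightarrow> 'a::comm_semiring_0"
  shows "sum a K * sum b K * sum c K * sum d K =
    (\<Sum>(k1, k2, k3, k4)\<in>K \<times> K \<times> K \<times> K. a k1 * b k2 * c k3 * d k4)"
  by (simp only: mult.assoc, simp add: sum_product_pairs split_def)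

lemma sum_cube_coeff:
  fixes c :: "'j \<Rightarrow> 'a::comm_semiring_1"
  shows "(\<Sum>k\<in>cube_freqs J. cube_coeff c k) = sum c J ^ 8"
proof -
  have "sum c J ^ 8 = (sum c J * sum c J) * (sum c J * sum c J) * (sum c J * sum c J) * (sum c J * sum c J)"
    by (simp add: eval_nat_numeral mult_ac)
  also have "sum c J * sum c J = (\<Sum>k\<in>J \<times> J. c (fst k) * c (snd k))"
    by (rule sum_product_pairs)
  also have "\<dots> * \<dots> * \<dots> * \<dots> = (\<Sum>k\<in>cube_freqs J. cube_coeff c k)"
    unfolding sum_product4 cube_freqs_def by (intro sum.cong) (auto simp: cube_coeff_def)
  finally show ?thesis ..
qed

lemma mult_derivs_expand:
  fixes lam \<theta> :: "'j \<Rightarrow> real"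
  assumes f: "\<And>n. f n = (\<Sum>j\<in>J. of_real (lam j) * e (- (\<theta> j * of_int n)))"
  shows "mult_derivs [h1, h2, h3] f x = (\<Sum>k\<in>cube_freqs J. of_real (cube_coeff lam k) *
    e (phase_x \<theta> k * x + phase_h1 \<theta> k * h1 + phase_h2 \<theta> k * h2 + phase_h3 \<theta> k * h3))"
proof -
  have deriv: "mult_deriv h1 f y =
    (\<Sum>k\<in>J \<times> J. of_real (lam (fst k) * lam (snd k)) * e (- (\<theta> (fst k) * y) + \<theta> (snd k) * (y + h1)))" for y
  proof -
    have "mult_deriv h1 f y = (\<Sum>k\<in>J \<times> J. of_real (lam (fst k)) * e (- (\<theta> (fst k) * y)) *
        cnj (of_real (lam (snd k)) * e (- (\<theta> (snd k) * of_int (y + h1)))))"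
      by (simp only: mult_deriv_def f cnj_sum sum_product_pairs)
    also have "\<dots> = (\<Sum>k\<in>J \<times> J. of_real (lam (fst k) * lam (snd k)) *
        e (- (\<theta> (fst k) * y) + \<theta> (snd k) * (y + h1)))"
      unfolding e_add by (intro sum.cong refl) (simp add: cnj_e mult_ac)
    finally show ?thesis .
  qed
  have cnj_deriv: "cnj (mult_deriv h1 f y) =
    (\<Sum>k\<in>J \<times> J. of_real (lam (fst k) * lam (snd k)) * e (\<theta> (fst k) * y - \<theta> (snd k) * (y + h1)))" for y
    unfolding deriv cnj_sum by (intro sum.cong refl) (simp add: cnj_e)
  show ?thesis
    \<comment> \<open>The two conjugated edges are expanded first, so that they receive the opposite
      phases before the plain expansion is applied to the other two.\<close>
    unfolding mult_derivs_three cnj_deriv unfolding deriv sum_product4 cube_freqs_def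
  proof (intro sum.cong refl)
    fix k assume "k \<in> (J \<times> J) \<times> (J \<times> J) \<times> (J \<times> J) \<times> J \<times> J"
    obtain i1 j1 i2 j2 i3 j3 i4 j4 where k: "k = ((i1, j1), (i2, j2), (i3, j3), (i4, j4))"
      by (metis prod.exhaust_sel)
    have "phase_x \<theta> k * x + phase_h1 \<theta> k * h1 + phase_h2 \<theta> k * h2 + phase_h3 \<theta> k * h3 =
      (- (\<theta> i1 * x) + \<theta> j1 * (x + h1)) + (\<theta> i2 * (x + h2) - \<theta> j2 * (x + h2 + h1))
      + (\<theta> i3 * (x + h3) - \<theta> j3 * (x + h3 + h1))
      + (- (\<theta> i4 * (x + h2 + h3)) + \<theta> j4 * (x + h2 + h3 + h1))"
      by (simp add: k phase_defs algebra_simps)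
    then show "(case k of (k1, k2, k3, k4) \<Rightarrow>
        of_real (lam (fst k1) * lam (snd k1)) * e (- (\<theta> (fst k1) * x) + \<theta> (snd k1) * (x + h1)) *
        (of_real (lam (fst k2) * lam (snd k2)) * e (\<theta> (fst k2) * (x + h2) - \<theta> (snd k2) * (x + h2 + h1))) *
        (of_real (lam (fst k3) * lam (snd k3)) * e (\<theta> (fst k3) * (x + h3) - \<theta> (snd k3) * (x + h3 + h1))) *
        (of_real (lam (fst k4) * lam (snd k4)) * e (- (\<theta> (fst k4) * (x + h2 + h3)) + \<theta> (snd k4) * (x + h2 + h3 + h1)))) =
      of_real (cube_coeff lam k) *
        e (phase_x \<theta> k * x + phase_h1 \<theta> k * h1 + phase_h2 \<theta> k * h2 + phase_h3 \<theta> k * h3)"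
      by (simp only: e_add) (simp add: k cube_coeff_def mult_ac)
  qed
qed

lemma cube_coeff_nonneg:
  fixes f :: "'j \<Rightarrow> real"
  assumes "k \<in> cube_freqs J" "\<And>j. j \<in> J \<Longrightarrow> 0 \<le> f j"
  shows "0 \<le> cube_coeff f k"
  using assms by (auto simp: cube_freqs_def cube_coeff_def)

lemma cube_coeff_mono:
  fixes f g :: "'j \<Rightarrow> real"
  assumes "k \<in> cube_freqs J" "\<And>j. j \<in> J \<Longrightarrow> 0 \<le> f j" "\<And>j. j \<in> J \<Longrightarrow> f j \<le> g j"
  shows "cube_coeff f k \<le> cube_coeff g k"
proof -
  have "0 \<le> g j" if "j \<in> J" for j
    using assms(2,3)[OF that] by simp
  then show ?thesis
    using assms unfolding cube_freqs_def cube_coeff_def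
    by (auto intro!: mult_mono mult_nonneg_nonneg)
qed

lemma finite_cube_freqs [simp]: "finite J \<Longrightarrow> finite (cube_freqs J)"
  by (simp add: cube_freqs_def)

text \<open>The product of all eight denominators is a multiple of each of them, so it clears every
  fraction in the four phases.\<close>

lemma phase_denominator:
  fixes \<theta> :: "'j \<Rightarrow> real"
  assumes k: "k \<in> cube_freqs J" and den: "\<And>j. j \<in> J \<Longrightarrow> real (den j) * \<theta> j \<in> \<int>"
  shows "real (cube_coeff den k) * phase_x \<theta> k \<in> \<int>" "real (cube_coeff den k) * phase_h1 \<theta> k \<in> \<int>"
    "real (cube_coeff den k) * phase_h2 \<theta> k \<in> \<int>" "real (cube_coeff den k) * phase_h3 \<theta> k \<in> \<int>"
proof -
  obtain i1 j1 i2 j2 i3 j3 i4 j4 where k_eq: "k = ((i1, j1), (i2, j2), (i3, j3), (i4, j4))"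
    by (metis prod.exhaust_sel)
  have J: "i1 \<in> J" "j1 \<in> J" "i2 \<in> J" "j2 \<in> J" "i3 \<in> J" "j3 \<in> J" "i4 \<in> J" "j4 \<in> J"
    using k by (auto simp: k_eq cube_freqs_def)
  define d where "d = real (cube_coeff den k)"
  have d: "d * \<theta> j \<in> \<int>" if "den j dvd cube_coeff den k" "j \<in> J" for j
  proof -
    obtain q where "cube_coeff den k = q * den j"
      using \<open>den j dvd _\<close> by (metis dvdE mult.commute)
    then have "d * \<theta> j = real q * (real (den j) * \<theta> j)"
      by (simp add: d_def)
    then show ?thesis using den[OF \<open>j \<in> J\<close>] by (metis Ints_mult Ints_of_nat)
  qed
  have "d * \<theta> i1 \<in> \<int>" "d * \<theta> j1 \<in> \<int>" "d * \<theta> i2 \<in> \<int>" "d * \<theta> j2 \<in> \<int>"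
    "d * \<theta> i3 \<in> \<int>" "d * \<theta> j3 \<in> \<int>" "d * \<theta> i4 \<in> \<int>" "d * \<theta> j4 \<in> \<int>"
    by (intro d J; simp add: k_eq cube_coeff_def)+
  then show "real (cube_coeff den k) * phase_x \<theta> k \<in> \<int>" "real (cube_coeff den k) * phase_h1 \<theta> k \<in> \<int>"
    "real (cube_coeff den k) * phase_h2 \<theta> k \<in> \<int>" "real (cube_coeff den k) * phase_h3 \<theta> k \<in> \<int>"
    unfolding d_def[symmetric]
    by (auto simp: k_eq phase_defs distrib_left right_diff_distrib intro!: Ints_add Ints_diff)
qed

text \<open>Resonant tuples get the trivial bound, the number of cubes. The others are controlled by
  \<open>norm_sum_cube_region_le\<close>, with the product of the eight denominators, at most
  \<open>B ^ 8\<close>, as the order. Extending this second bound to all tuples makes the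
  coefficient sum an exact eighth power.\<close>

lemma cube_sum_le_resonant:
  fixes lam \<theta> :: "'j \<Rightarrow> real" and B :: real
  assumes J: "finite J" and f: "\<And>n. f n = (\<Sum>j\<in>J. of_real (lam j) * e (- (\<theta> j * of_int n)))"
    and den: "\<And>j. j \<in> J \<Longrightarrow> 0 < den j" "\<And>j. j \<in> J \<Longrightarrow> real (den j) * \<theta> j \<in> \<int>"
      "\<And>j. j \<in> J \<Longrightarrow> real (den j) \<le> B"
    and M: "M \<ge> 0"
  shows "Re (\<Sum>(x, h1, h2, h3)\<in>cube_region M. mult_derivs [h1, h2, h3] f x) \<le>
    (2 * real_of_int M + 1) ^ 4 * (\<Sum>k | k \<in> cube_freqs J \<and> resonant \<theta> k. cube_coeff (\<lambda>j. \<bar>lam j\<bar>) k)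
    + B ^ 8 * (2 * real_of_int M + 1) ^ 3 * (\<Sum>j\<in>J. \<bar>lam j\<bar>) ^ 8"
proof -
  define V where "V = (\<lambda>k. \<Sum>(x, h1, h2, h3)\<in>cube_region M.
    e (phase_x \<theta> k * x + phase_h1 \<theta> k * h1 + phase_h2 \<theta> k * h2 + phase_h3 \<theta> k * h3))"
  define N where "N = 2 * real_of_int M + 1"
  define c where "c = cube_coeff (\<lambda>j. \<bar>lam j\<bar>)"
  have N: "N \<ge> 0" using M by (simp add: N_def)
  have c: "0 \<le> c k" "\<bar>cube_coeff lam k\<bar> = c k" if "k \<in> cube_freqs J" for k
    using that by (auto simp: c_def cube_coeff_def abs_mult split: prod.splits)
  have triv: "norm (V k) \<le> N ^ 4" for k
  proof -
    have "norm (V k) \<le> (\<Sum>v\<in>cube_region M. 1)"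
      unfolding V_def by (rule sum_norm_le) (auto simp: split_beta)
    also have "\<dots> \<le> N ^ 4" using card_cube_region_le[OF M] by (simp add: N_def)
    finally show ?thesis .
  qed
  have nonres: "norm (V k) \<le> B ^ 8 * N ^ 3" if k: "k \<in> cube_freqs J" and "\<not> resonant \<theta> k" for k
  proof -
    have pos: "0 < cube_coeff den k"
      using k den(1) by (auto simp: cube_coeff_def cube_freqs_def)
    have "norm (V k) \<le> cube_coeff den k * N ^ 3"
      unfolding V_def N_def using \<open>\<not> resonant \<theta> k\<close> phase_denominator[OF k den(2)] pos M
      by (intro norm_sum_cube_region_le) (auto simp: resonant_def)
    also have "real (cube_coeff den k) = cube_coeff (\<lambda>j. real (den j)) k"
      by (simp add: cube_coeff_def split: prod.splits)
    also have "\<dots> \<le> cube_coeff (\<lambda>_. B) k"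
      by (rule cube_coeff_mono[OF k]) (use den(3) in auto)
    also have "\<dots> = B ^ 8"
      by (simp add: cube_coeff_def eval_nat_numeral mult_ac split: prod.splits)
    finally show ?thesis using N by (simp add: mult_right_mono)
  qed
  have "(\<Sum>(x, h1, h2, h3)\<in>cube_region M. mult_derivs [h1, h2, h3] f x) =
    (\<Sum>k\<in>cube_freqs J. of_real (cube_coeff lam k) * V k)"
    unfolding mult_derivs_expand[OF f] V_def split_beta sum_distrib_left by (rule sum.swap)
  then have "Re (\<Sum>(x, h1, h2, h3)\<in>cube_region M. mult_derivs [h1, h2, h3] f x) \<le>
    norm (\<Sum>k\<in>cube_freqs J. of_real (cube_coeff lam k) * V k)"
    by (simp only: complex_Re_le_cmod)
  also have "\<dots> \<le> (\<Sum>k\<in>cube_freqs J. (if resonant \<theta> k then N ^ 4 * c k else 0) + B ^ 8 * N ^ 3 * c k)"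
  proof (rule sum_norm_le)
    fix k assume k: "k \<in> cube_freqs J"
    have "0 \<le> B ^ 8" by simp
    then have "0 \<le> B ^ 8 * N ^ 3" using N by simp
    have "norm (of_real (cube_coeff lam k) * V k) = c k * norm (V k)"
      using c(2)[OF k] by (simp add: norm_mult)
    also have "\<dots> \<le> c k * ((if resonant \<theta> k then N ^ 4 else 0) + B ^ 8 * N ^ 3)"
      using triv[of k] nonres[OF k] \<open>0 \<le> B ^ 8 * N ^ 3\<close> by (intro mult_left_mono c(1)[OF k]) auto
    also have "\<dots> = (if resonant \<theta> k then N ^ 4 * c k else 0) + B ^ 8 * N ^ 3 * c k"
      by (simp add: algebra_simps)
    finally show "norm (of_real (cube_coeff lam k) * V k) \<le>
      (if resonant \<theta> k then N ^ 4 * c k else 0) + B ^ 8 * N ^ 3 * c k" .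
  qed
  also have "\<dots> = N ^ 4 * (\<Sum>k | k \<in> cube_freqs J \<and> resonant \<theta> k. c k) + B ^ 8 * N ^ 3 * (\<Sum>k\<in>cube_freqs J. c k)"
    using J by (simp add: sum.distrib flip: sum_distrib_left sum.inter_filter)
  finally show ?thesis
    by (simp add: N_def c_def sum_cube_coeff)
qed

text \<open>Resonance amounts to four congruences modulo \<open>P\<close> between the eight
  numerators, so the difference along the first edge and three of the end frequencies determine the
  rest. Numerators are distinct modulo \<open>P\<close>, hence the tuple is recovered from these
  four residues.\<close>

lemma resonant_sum_le:
  fixes lam \<theta> :: "'j \<Rightarrow> real" and A :: "'j \<Rightarrow> int"
  assumes J: "finite J" and P: "P > 0" and \<theta>: "\<And>j. \<theta> j = A j / P"
    and inj: "\<And>i j. i \<in> J \<Longrightarrow> j \<in> J \<Longrightarrow> A i mod P = A j mod P \<Longrightarrow> i = j"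
    and W: "mod_invariant P W" "\<And>x. 0 \<le> W x"
    and lam: "\<And>j. j \<in> J \<Longrightarrow> \<bar>lam j\<bar> \<le> \<kappa> * W (A j)"
  shows "(\<Sum>k | k \<in> cube_freqs J \<and> resonant \<theta> k. cube_coeff (\<lambda>j. \<bar>lam j\<bar>) k) \<le> \<kappa> ^ 8 * cube_sum P W"
proof -
  define Res where "Res = {k \<in> cube_freqs J. resonant \<theta> k}"
  define \<psi> where "\<psi> = (\<lambda>((i1 :: 'j, j1 :: 'j), (i2 :: 'j, j2 :: 'j), (i3 :: 'j, j3 :: 'j), (i4 :: 'j, j4 :: 'j)).
    ((A i1 - A j1) mod P, A j1 mod P, A j2 mod P, A j3 mod P))"
  have cong: "A i2 mod P = (A i1 - A j1 + A j2) mod P" "A i3 mod P = (A i1 - A j1 + A j3) mod P"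
      "A i4 mod P = (A i1 - A j1 + (A j2 + A j3 - A j1)) mod P" "A j4 mod P = (A j2 + A j3 - A j1) mod P"
    if "((i1, j1), (i2, j2), (i3, j3), (i4, j4)) \<in> Res" for i1 j1 i2 j2 i3 j3 i4 j4
  proof -
    let ?k = "((i1, j1), (i2, j2), (i3, j3), (i4, j4))"
    have "phase_x \<theta> ?k = phase_x A ?k / P" "phase_h1 \<theta> ?k = phase_h1 A ?k / P"
      "phase_h2 \<theta> ?k = phase_h2 A ?k / P" "phase_h3 \<theta> ?k = phase_h3 A ?k / P"
      by (simp_all add: phase_defs \<theta> diff_divide_distrib add_divide_distrib)
    then have dvd: "P dvd phase_x A ?k" "P dvd phase_h1 A ?k" "P dvd phase_h2 A ?k" "P dvd phase_h3 A ?k"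
      using that P by (simp_all add: Res_def resonant_def of_int_div_of_int_in_Ints_iff)
    \<comment> \<open>The four phases are solved for \<open>i2\<close>, \<open>i3\<close>,
      \<open>i4\<close> and \<open>j4\<close>, in the parametrization used by
      \<open>cube_weight\<close>.\<close>
    have "A i2 - (A i1 - A j1 + A j2) = phase_x A ?k - phase_h3 A ?k"
      "A i3 - (A i1 - A j1 + A j3) = phase_x A ?k - phase_h2 A ?k"
      "A i4 - (A i1 - A j1 + (A j2 + A j3 - A j1)) = phase_x A ?k - phase_h2 A ?k - phase_h3 A ?k + phase_h1 A ?k"
      "A j4 - (A j2 + A j3 - A j1) = phase_h1 A ?k"
      by (simp_all add: phase_defs)
    with dvd show "A i2 mod P = (A i1 - A j1 + A j2) mod P" "A i3 mod P = (A i1 - A j1 + A j3) mod P"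
      "A i4 mod P = (A i1 - A j1 + (A j2 + A j3 - A j1)) mod P" "A j4 mod P = (A j2 + A j3 - A j1) mod P"
      by (simp_all only: mod_eq_dvd_iff dvd_diff dvd_add)
  qed
  have weight: "cube_coeff (\<lambda>j. W (A j)) k = (case \<psi> k of (s, t1, t2, t3) \<Rightarrow> cube_weight W s t1 t2 t3)"
    if "k \<in> Res" for k
  proof -
    obtain i1 j1 i2 j2 i3 j3 i4 j4 where k: "k = ((i1, j1), (i2, j2), (i3, j3), (i4, j4))"
      by (metis prod.exhaust_sel)
    note cong_k = cong[OF that[unfolded k]]
    have "cube_coeff (\<lambda>j. W (A j)) k = cube_weight W (A i1 - A j1) (A j1) (A j2) (A j3)"
      using cong_k[THEN mod_invariantD[OF W(1)]]
      by (simp add: k cube_coeff_def cube_weight_def mult_ac)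
    also have "\<dots> = cube_weight W ((A i1 - A j1) mod P) (A j1 mod P) (A j2 mod P) (A j3 mod P)"
      by (rule cube_weight_cong[OF W(1)]) simp_all
    finally show ?thesis by (simp add: k \<psi>_def)
  qed
  have inj_\<psi>: "inj_on \<psi> Res"
  proof (rule inj_onI)
    fix k k' assume res: "k \<in> Res" "k' \<in> Res" and eq: "\<psi> k = \<psi> k'"
    obtain i1 j1 i2 j2 i3 j3 i4 j4 where k: "k = ((i1, j1), (i2, j2), (i3, j3), (i4, j4))"
      by (metis prod.exhaust_sel)
    obtain i1' j1' i2' j2' i3' j3' i4' j4' where k': "k' = ((i1', j1'), (i2', j2'), (i3', j3'), (i4', j4'))"
      by (metis prod.exhaust_sel)
    have mem: "i1 \<in> J" "j1 \<in> J" "i2 \<in> J" "j2 \<in> J" "i3 \<in> J" "j3 \<in> J" "i4 \<in> J" "j4 \<in> J"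
        "i1' \<in> J" "j1' \<in> J" "i2' \<in> J" "j2' \<in> J" "i3' \<in> J" "j3' \<in> J" "i4' \<in> J" "j4' \<in> J"
      using res by (auto simp: k k' Res_def cube_freqs_def)
    note cong_k = cong[OF res(1)[unfolded k]] and cong_k' = cong[OF res(2)[unfolded k']]
    have s: "(A i1 - A j1) mod P = (A i1' - A j1') mod P" and t: "A j1 mod P = A j1' mod P"
      "A j2 mod P = A j2' mod P" "A j3 mod P = A j3' mod P"
      using eq by (simp_all add: \<psi>_def k k')
    have "A i1 mod P = A i1' mod P"
      using mod_add_cong[OF s t(1)] by simp
    moreover have "A i2 mod P = A i2' mod P" "A i3 mod P = A i3' mod P" "A i4 mod P = A i4' mod P"
        "A j4 mod P = A j4' mod P"
      unfolding cong_k cong_k' by (intro mod_add_cong mod_diff_cong s t)+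
    ultimately show "k = k'"
      using inj mem t by (simp add: k k')
  qed
  have "(\<Sum>k\<in>Res. cube_coeff (\<lambda>j. \<bar>lam j\<bar>) k) \<le> (\<Sum>k\<in>Res. cube_coeff (\<lambda>j. \<kappa> * W (A j)) k)"
    by (intro sum_mono cube_coeff_mono[of _ J]) (auto simp: Res_def lam)
  also have "\<dots> = \<kappa> ^ 8 * (\<Sum>k\<in>Res. cube_coeff (\<lambda>j. W (A j)) k)"
    unfolding sum_distrib_left
    by (intro sum.cong refl) (simp add: cube_coeff_def eval_nat_numeral mult_ac split: prod.splits)
  also have "(\<Sum>k\<in>Res. cube_coeff (\<lambda>j. W (A j)) k) =
    (\<Sum>(s, t1, t2, t3)\<in>\<psi> ` Res. cube_weight W s t1 t2 t3)"
    by (simp add: sum.reindex[OF inj_\<psi>] weight)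
  \<comment> \<open>Residues that come from no tuple are added; their weights are
    nonnegative.\<close>
  also have "\<dots> \<le> (\<Sum>(s, t1, t2, t3)\<in>{0..<P} \<times> {0..<P} \<times> {0..<P} \<times> {0..<P}. cube_weight W s t1 t2 t3)"
    using P by (intro sum_mono2) (auto simp: \<psi>_def cube_weight_nonneg W(2))
  also have "\<dots> = cube_sum P W"
    by (simp add: cube_sum_def sum.cartesian_product split_beta)
  finally show ?thesis by (simp add: Res_def mult_left_mono)
qed

section \<open>Frequencies with squarefree denominators\<close>

definition admissible_moduli :: "real \<Rightarrow> nat set" where
  "admissible_moduli Q = {q. Q / 2 \<le> real q \<and> real q < Q \<and> squarefree q}"

definition Lambda_freqs :: "real \<Rightarrow> (nat \<times> nat) set" where
  "Lambda_freqs Q = (SIGMA q:admissible_moduli Q. totatives q)"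

definition Lambda_coeff :: "nat \<times> nat \<Rightarrow> real" where
  "Lambda_coeff = (\<lambda>(q, a). of_int (moebius_mu q) / totient q)"

definition primes_below :: "real \<Rightarrow> int set" where
  "primes_below Q = int ` {p. prime p \<and> real p < Q}"

text \<open>All frequencies \<open>a / q\<close> are written as fractions over the common denominator \<open>\<Prod>(primes_below Q)\<close>.\<close>

definition Lambda_num :: "real \<Rightarrow> nat \<times> nat \<Rightarrow> int" where
  "Lambda_num Q = (\<lambda>(q, a). int a * \<Prod>(primes_below Q - int ` prime_factors q))"

lemma finite_nats_below: "finite {q. real q < Q}"
proof (rule finite_subset)
  show "{q. real q < Q} \<subseteq> {..<nat \<lceil>Q\<rceil>}" by (auto simp: zless_nat_eq_int_zless) linarith
qed simp

lemma finite_primes_below [simp]: "finite (primes_below Q)"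
  unfolding primes_below_def by (intro finite_imageI finite_subset[OF _ finite_nats_below[of Q]]) auto

lemma prime_primes_below: "p \<in> primes_below Q \<Longrightarrow> prime p"
  by (auto simp: primes_below_def)

lemma prod_primes_below_pos: "0 < \<Prod>(primes_below Q)"
  by (intro prod_pos) (auto dest: prime_primes_below prime_gt_0_int)

lemma finite_admissible_moduli [simp]: "finite (admissible_moduli Q)"
  by (rule finite_subset[OF _ finite_nats_below[of Q]]) (auto simp: admissible_moduli_def)

lemma finite_Lambda_freqs [simp]: "finite (Lambda_freqs Q)"
  by (simp add: Lambda_freqs_def)

lemma card_admissible_moduli_le:
  fixes Q :: real
  assumes "Q > 0"
  shows "card (admissible_moduli Q) \<le> Q"
proof -
  \<comment> \<open>The bounds are strict on both sides, so there are at most \<lceil>Q\<rceil> - 1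
    moduli, and this is at most \<open>Q\<close> even when \<open>Q\<close> is not an
    integer.\<close>
  have "admissible_moduli Q \<subseteq> {0<..<nat \<lceil>Q\<rceil>}"
  proof
    fix q assume q: "q \<in> admissible_moduli Q"
    then have "0 < real q" "real q < \<lceil>Q\<rceil>"
      using assms less_le_trans[OF _ le_of_int_ceiling] by (auto simp: admissible_moduli_def)
    then show "q \<in> {0<..<nat \<lceil>Q\<rceil>}" by auto
  qed
  then have "card (admissible_moduli Q) \<le> nat \<lceil>Q\<rceil> - 1"
    using card_mono[of "{0<..<nat \<lceil>Q\<rceil>}"] by fastforce
  moreover have "1 \<le> nat \<lceil>Q\<rceil>" using assms by linarith
  ultimately have "real (card (admissible_moduli Q)) \<le> real (nat \<lceil>Q\<rceil>) - 1"
    by linarith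
  also have "\<dots> \<le> Q" using assms by linarith
  finally show ?thesis .
qed

lemma prod_prime_factors_squarefree:
  fixes q :: nat
  assumes "squarefree q"
  shows "\<Prod>(prime_factors q) = q"
proof -
  have "q \<noteq> 0" using assms by (metis not_squarefree_0)
  have "\<Prod>(prime_factors q) = (\<Prod>p\<in>prime_factors q. p ^ multiplicity p q)"
    using assms \<open>q \<noteq> 0\<close> by (intro prod.cong refl) (simp add: squarefree_factorial_semiring')
  then show ?thesis using prod_prime_factors[OF \<open>q \<noteq> 0\<close>] by simp
qed

lemma totient_squarefree:
  fixes q :: nat
  assumes "squarefree q"
  shows "totient q = (\<Prod>p\<in>prime_factors q. p - 1)"
proof -
  have "totient (\<Prod>p\<in>prime_factors q. p) = (\<Prod>p\<in>prime_factors q. totient p)"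
    by (rule totient_prod_coprime) (auto simp: pairwise_def intro: primes_coprime)
  also have "\<dots> = (\<Prod>p\<in>prime_factors q. p - 1)"
    by (intro prod.cong refl totient_prime) (auto simp: in_prime_factors_iff)
  finally show ?thesis by (simp add: prod_prime_factors_squarefree[OF assms])
qed

lemma prod_powr_totient:
  assumes "squarefree q"
  shows "(\<Prod>p\<in>prime_factors q. real p powr \<gamma> / (real p - 1)) = real q powr \<gamma> / totient q"
proof -
  have "real q = (\<Prod>p\<in>prime_factors q. real p)"
    using arg_cong[OF prod_prime_factors_squarefree[OF assms], of real] by simp
  then have "real q powr \<gamma> = (\<Prod>p\<in>prime_factors q. real p powr \<gamma>)"
    by (simp add: prod_powr_distrib)
  moreover have "real (totient q) = (\<Prod>p\<in>prime_factors q. real p - 1)"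
    unfolding totient_squarefree[OF assms] of_nat_prod
    by (intro prod.cong refl) (auto simp: of_nat_diff in_prime_factors_iff Suc_leI prime_gt_0_nat)
  ultimately show ?thesis by (simp add: prod_dividef)
qed

context
  fixes Q :: real and q a :: nat
  assumes Q: "Q > 0" and mem: "(q, a) \<in> Lambda_freqs Q"
begin

lemma Lambda_freqs_mod: "squarefree q" "0 < q" "real q < Q" "Q / 2 \<le> q"
    "0 < a" "a \<le> q" "coprime a q"
  using mem Q by (auto simp: Lambda_freqs_def admissible_moduli_def in_totatives_iff intro: Nat.gr0I)

lemma prime_factors_subset_primes_below: "int ` prime_factors q \<subseteq> primes_below Q"
proof
  fix p assume "p \<in> int ` prime_factors q"
  then obtain r where r: "p = int r" "prime r" "r dvd q"
    by (auto simp: in_prime_factors_iff)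
  then have "r \<le> q" using Lambda_freqs_mod by (auto intro: dvd_imp_le)
  then show "p \<in> primes_below Q"
    using r Lambda_freqs_mod by (auto simp: primes_below_def)
qed

lemma prod_primes_below_eq:
  "\<Prod>(primes_below Q) = int q * \<Prod>(primes_below Q - int ` prime_factors q)"
proof -
  have "\<Prod>(int ` prime_factors q) = int (\<Prod>(prime_factors q))"
    by (simp add: prod.reindex)
  then have "\<Prod>(int ` prime_factors q) = int q"
    using prod_prime_factors_squarefree Lambda_freqs_mod by simp
  then show ?thesis
    using prod.subset_diff[OF prime_factors_subset_primes_below finite_primes_below, of "\<lambda>p. p"]
    by (simp add: mult.commute)
qed

lemma Lambda_num_div: "Lambda_num Q (q, a) / \<Prod>(primes_below Q) = real a / real q"
proof -
  have "\<Prod>(primes_below Q - int ` prime_factors q) \<noteq> 0"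
    using prod_primes_below_eq prod_primes_below_pos[of Q] by (metis less_irrefl mult_zero_right)
  then show ?thesis
    unfolding prod_primes_below_eq by (simp add: Lambda_num_def del: of_int_prod)
qed

text \<open>The cofactor of \<open>a\<close> contains exactly the primes below \<open>Q\<close> that
  are not factors of \<open>q\<close>, and \<open>a\<close> itself is coprime to
  \<open>q\<close>.\<close>

lemma dvd_Lambda_num_iff:
  assumes p: "p \<in> primes_below Q"
  shows "p dvd Lambda_num Q (q, a) \<longleftrightarrow> p \<notin> int ` prime_factors q"
proof
  assume "p \<notin> int ` prime_factors q"
  then show "p dvd Lambda_num Q (q, a)"
    using p by (auto simp: Lambda_num_def intro!: dvd_mult dvd_prodI)
next
  assume dvd: "p dvd Lambda_num Q (q, a)"
  show "p \<notin> int ` prime_factors q"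
  proof
    assume pq: "p \<in> int ` prime_factors q"
    then obtain r where r: "p = int r" "prime r" "r dvd q"
      by (auto simp: in_prime_factors_iff)
    have "coprime r a"
      using Lambda_freqs_mod(7) coprime_divisors[OF dvd_refl r(3)] by (simp add: coprime_commute)
    then have "coprime p (int a)" by (simp add: r(1))
    moreover have "coprime p (\<Prod>(primes_below Q - int ` prime_factors q))"
      using pq p by (intro prod_coprime_right primes_coprime) (auto dest: prime_primes_below)
    ultimately have "coprime p (Lambda_num Q (q, a))"
      by (simp add: Lambda_num_def)
    then have "is_unit p" using dvd by (auto dest: coprime_common_divisor)
    then show False using prime_primes_below[OF p] not_prime_unit by blast
  qed
qed

lemma prime_factors_eq_Lambda_num:
  "int ` prime_factors q = {p \<in> primes_below Q. \<not> p dvd Lambda_num Q (q, a)}"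
  using dvd_Lambda_num_iff prime_factors_subset_primes_below by blast

text \<open>By the divisibility criterion the local weight sees precisely the prime factors of
  \<open>q\<close>. This connects the Rankin weight of a frequency with the periodic weight in the
  cube sum.\<close>

lemma local_weight_Lambda_num:
  "local_weight (\<lambda>p. p powr \<gamma> / (p - 1)) (primes_below Q) (Lambda_num Q (q, a)) = real q powr \<gamma> / totient q"
proof -
  have "local_weight (\<lambda>p. p powr \<gamma> / (p - 1)) (primes_below Q) (Lambda_num Q (q, a)) =
    (\<Prod>p\<in>primes_below Q. if p \<in> int ` prime_factors q then p powr \<gamma> / (p - 1) else 1)"
    unfolding local_weight_def by (intro prod.cong refl) (use dvd_Lambda_num_iff in auto)
  also have "\<dots> = (\<Prod>p\<in>int ` prime_factors q. p powr \<gamma> / (p - 1))"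
    using prime_factors_subset_primes_below by (intro prod.mono_neutral_cong_right) auto
  also have "\<dots> = (\<Prod>p\<in>prime_factors q. real p powr \<gamma> / (real p - 1))"
    by (simp add: prod.reindex)
  finally show ?thesis
    using prod_powr_totient Lambda_freqs_mod(1) by simp
qed

lemma abs_Lambda_coeff_le: "\<bar>Lambda_coeff (q, a)\<bar> \<le> 1 / totient q"
  by (auto simp: Lambda_coeff_def moebius_mu_def power_abs)

end

text \<open>Reduced fractions in (0, 1] are distinct modulo 1: the primes not dividing the numerator
  recover the squarefree \<open>q\<close>, then \<open>a\<close> is known modulo \<open>q\<close>,
  and it lies between 1 and \<open>q\<close>.\<close>

lemma Lambda_num_inj:
  assumes Q: "Q > 0" and mem: "i \<in> Lambda_freqs Q" "j \<in> Lambda_freqs Q"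
    and eq: "Lambda_num Q i mod \<Prod>(primes_below Q) = Lambda_num Q j mod \<Prod>(primes_below Q)"
  shows "i = j"
proof -
  obtain q a q' a' where ij: "i = (q, a)" "j = (q', a')" by (metis surj_pair)
  note mem = mem[unfolded ij] and eq = eq[unfolded ij]
  have "p dvd Lambda_num Q (q, a) \<longleftrightarrow> p dvd Lambda_num Q (q', a')" if "p \<in> primes_below Q" for p
  proof -
    have "p dvd \<Prod>(primes_below Q)" using that by (intro dvd_prodI) auto
    from dvd_mod_iff[OF this, of "Lambda_num Q (q, a)"] dvd_mod_iff[OF this, of "Lambda_num Q (q', a')"]
    show ?thesis using eq by simp
  qed
  then have factors: "int ` prime_factors q = int ` prime_factors q'"
    unfolding prime_factors_eq_Lambda_num[OF Q mem(1)] prime_factors_eq_Lambda_num[OF Q mem(2)] by blast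
  then have "prime_factors q = prime_factors q'"
    by (simp add: inj_image_eq_iff)
  then have q: "q = q'"
    using prod_prime_factors_squarefree Lambda_freqs_mod(1)[OF Q mem(1)] Lambda_freqs_mod(1)[OF Q mem(2)]
    by metis
  define R where "R = \<Prod>(primes_below Q - int ` prime_factors q)"
  have P: "\<Prod>(primes_below Q) = int q * R"
    using prod_primes_below_eq[OF Q mem(1)] by (simp add: R_def)
  have "R \<noteq> 0" using P prod_primes_below_pos[of Q] by (metis less_irrefl mult_zero_right)
  have "int q * R dvd int a * R - int a' * R"
    using eq unfolding P by (simp only: Lambda_num_def prod.case mod_eq_dvd_iff R_def factors)
  then have "int q dvd int a - int a'"
    using \<open>R \<noteq> 0\<close> by (simp flip: left_diff_distrib)
  moreover have "\<bar>int a - int a'\<bar> < int q"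
    using Lambda_freqs_mod(5,6)[OF Q mem(1)] Lambda_freqs_mod(5,6)[OF Q mem(2)] q by linarith
  ultimately have "int a - int a' = 0"
    using dvd_imp_le_int[of "int a - int a'" "int q"] by linarith
  then show ?thesis using q ij by simp
qed

lemma Lambda_Q_eq:
  assumes Q: "Q > 0"
  shows "Lambda_Q Q n = (\<Sum>j\<in>Lambda_freqs Q. of_real (Lambda_coeff j) *
    e (- (Lambda_num Q j / \<Prod>(primes_below Q) * of_int n)))"
proof -
  have fin: "finite {q. Q / 2 \<le> real q \<and> real q < Q}"
    by (rule finite_subset[OF _ finite_nats_below[of Q]]) auto
  have totatives: "{a. 1 \<le> a \<and> a \<le> q \<and> coprime a q} = totatives q" for q
    by (auto simp: in_totatives_iff)
  have "Lambda_Q Q n = (\<Sum>q\<in>admissible_moduli Q. of_int (moebius_mu q) / of_nat (totient q) * ramanujan_sum q n)"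
    unfolding Lambda_Q_def using fin
    by (intro sum.mono_neutral_right) (auto simp: admissible_moduli_def moebius_mu_def)
  also have "\<dots> = (\<Sum>(q, a)\<in>Lambda_freqs Q. of_int (moebius_mu q) / of_nat (totient q) * e (- (real a * n / real q)))"
    unfolding ramanujan_sum_def totatives sum_distrib_left Lambda_freqs_def by (simp add: sum.Sigma)
  also have "\<dots> = (\<Sum>j\<in>Lambda_freqs Q. of_real (Lambda_coeff j) *
    e (- (Lambda_num Q j / \<Prod>(primes_below Q) * of_int n)))"
  proof (rule sum.cong[OF refl], clarify)
    fix q a assume "(q, a) \<in> Lambda_freqs Q"
    note div = Lambda_num_div[OF Q this]
    show "of_int (moebius_mu q) / of_nat (totient q) * e (- (real a * n / real q)) =
      of_real (Lambda_coeff (q, a)) * e (- (Lambda_num Q (q, a) / \<Prod>(primes_below Q) * of_int n))"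
      unfolding div by (simp add: Lambda_coeff_def)
  qed
  finally show ?thesis .
qed

text \<open>Each modulus has \<phi>(q) frequencies with coefficients at most 1/\<phi>(q), so it
  contributes at most 1.\<close>

lemma sum_abs_Lambda_coeff_le:
  assumes Q: "Q > 0"
  shows "(\<Sum>j\<in>Lambda_freqs Q. \<bar>Lambda_coeff j\<bar>) \<le> Q"
proof -
  have "(\<Sum>j\<in>Lambda_freqs Q. \<bar>Lambda_coeff j\<bar>) \<le> (\<Sum>(q, a)\<in>Lambda_freqs Q. 1 / totient q)"
    by (rule sum_mono) (auto intro!: abs_Lambda_coeff_le[OF Q])
  also have "\<dots> = (\<Sum>q\<in>admissible_moduli Q. \<Sum>a\<in>totatives q. 1 / totient q)"
    by (simp add: Lambda_freqs_def sum.Sigma del: sum_constant)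
  also have "\<dots> \<le> (\<Sum>q\<in>admissible_moduli Q. 1)"
    by (rule sum_mono) (simp add: totient_def[symmetric])
  also have "\<dots> \<le> Q" using card_admissible_moduli_le[OF Q] by simp
  finally show ?thesis .
qed

section \<open>Combining the resonant and non-resonant bounds\<close>

theorem proposition2p1:
  fixes \<epsilon> :: real
  assumes "\<epsilon> > 0"
  shows "\<exists>C::real. \<forall>(Q::real) (M::int). Q \<ge> 1 \<longrightarrow> real_of_int M \<ge> Q ^ 20 \<longrightarrow>
           U3_norm_interval M (Lambda_Q Q) \<le> C * Q powr (\<epsilon> - 3 / 8)"
proof -
  \<comment> \<open>The cap 1/24 is what the local factors require; since \<open>Q \<ge> 1\<close>,
    a bound with \<delta> \<le> \<epsilon> implies the one with \<epsilon>.\<close>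
  define \<delta> where "\<delta> = min \<epsilon> (1 / 24)"
  have \<delta>: "0 < \<delta>" "\<delta> \<le> 1 / 24" "\<delta> \<le> \<epsilon>" using assms by (auto simp: \<delta>_def)
  define \<gamma> where "\<gamma> = 3 / 8 - \<delta>"
  have \<gamma>: "0 \<le> \<gamma>" "8 * \<gamma> \<le> 3" using \<delta> by (auto simp: \<gamma>_def)
  obtain C where C: "C > 0" and cube_sum_le: "\<And>A. finite A \<Longrightarrow> \<forall>p\<in>A. prime p \<Longrightarrow>
      cube_sum (\<Prod>A) (local_weight (\<lambda>p. p powr (3 / 8 - \<delta>) / (p - 1)) A) \<le> C"
    using cube_sum_primes_bounded[OF \<delta>(1,2)] by blast
  \<comment> \<open>Here 648 = 3^4 * 8 comes from the resonant part, 27 = 3^3 from the non-resonant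
    part, and 256 = 4^4 from the lower bound on the number of cubes.\<close>
  define K where "K = 256 * (648 * C + 27)"
  have "U3_norm_interval M (Lambda_Q Q) \<le> root 8 K * Q powr (\<epsilon> - 3 / 8)"
    if Q: "Q \<ge> 1" and M: "real_of_int M \<ge> Q ^ 20" for Q M
  proof -
    have "1 \<le> Q ^ 20" using Q by simp
    then have M1: "M \<ge> 1" using M by linarith
    define P where "P = \<Prod>(primes_below Q)"
    define W where "W = local_weight (\<lambda>p. p powr \<gamma> / (p - 1)) (primes_below Q)"
    define \<theta> where "\<theta> = (\<lambda>j. Lambda_num Q j / P)"
    define \<kappa> where "\<kappa> = (Q / 2) powr (- \<gamma>)"
    define Res where "Res = (\<Sum>k | k \<in> cube_freqs (Lambda_freqs Q) \<and> resonant \<theta> k. cube_coeff (\<lambda>j. \<bar>Lambda_coeff j\<bar>) k)"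
    have Q0: "Q > 0" using Q by simp
    have W_nonneg: "0 \<le> W x" for x
      unfolding W_def local_weight_def
      by (intro prod_nonneg) (auto dest!: prime_primes_below prime_ge_1_int)
    have "Res \<le> \<kappa> ^ 8 * cube_sum P W"
      unfolding Res_def
    proof (rule resonant_sum_le[where A = "Lambda_num Q"])
      show "mod_invariant P W"
        unfolding P_def W_def by (rule mod_invariant_local_weight)
      show "P > 0" unfolding P_def by (rule prod_primes_below_pos)
      show "i = j" if "i \<in> Lambda_freqs Q" "j \<in> Lambda_freqs Q" "Lambda_num Q i mod P = Lambda_num Q j mod P" for i j
        using that unfolding P_def by (rule Lambda_num_inj[OF Q0])
      fix j assume "j \<in> Lambda_freqs Q"
      then obtain q a where j: "j = (q, a)" and mem: "(q, a) \<in> Lambda_freqs Q" by (metis surj_pair)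
      \<comment> \<open>Rankin's trick: \<open>q \<ge> Q / 2\<close>, so inserting this factor only
        enlarges the coefficient and makes the weight multiplicative in \<open>q\<close>.\<close>
      have "1 \<le> \<kappa> * real q powr \<gamma>"
      proof -
        have "(Q / 2) powr \<gamma> \<le> real q powr \<gamma>"
          using Lambda_freqs_mod(4)[OF Q0 mem] Q \<gamma> by (intro powr_mono2) auto
        then have "\<kappa> * (Q / 2) powr \<gamma> \<le> \<kappa> * real q powr \<gamma>"
          by (intro mult_left_mono) (simp_all add: \<kappa>_def)
        moreover have "\<kappa> * (Q / 2) powr \<gamma> = 1"
          using Q by (simp add: \<kappa>_def flip: powr_add)
        ultimately show ?thesis by simp
      qed
      then have "1 / totient q \<le> \<kappa> * real q powr \<gamma> / totient q"
        by (intro divide_right_mono) auto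
      then show "\<bar>Lambda_coeff j\<bar> \<le> \<kappa> * W (Lambda_num Q j)"
        using abs_Lambda_coeff_le[OF Q0 mem] local_weight_Lambda_num[OF Q0 mem, of \<gamma>]
        by (simp add: W_def j)
    qed (simp_all add: W_nonneg \<theta>_def)
    also have "\<dots> \<le> \<kappa> ^ 8 * C"
      unfolding P_def W_def \<gamma>_def
      by (intro mult_left_mono cube_sum_le) (auto dest: prime_primes_below)
    \<comment> \<open>The constant 8 bounds 2^(8\<gamma>), because 8\<gamma> \<le> 3.\<close>
    also have "\<kappa> ^ 8 \<le> 8 * Q powr (- 8 * \<gamma>)"
    proof -
      have "\<kappa> ^ 8 = (Q / 2) powr (- 8 * \<gamma>)"
        using Q by (simp add: \<kappa>_def powr_power)
      also have "\<dots> = (2 powr (8 * \<gamma>) * 2 powr (- 8 * \<gamma>)) * (Q / 2) powr (- 8 * \<gamma>)"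
        by (simp flip: powr_add)
      also have "\<dots> = 2 powr (8 * \<gamma>) * Q powr (- 8 * \<gamma>)"
        using powr_mult[of 2 "Q / 2" "- 8 * \<gamma>"] Q by (simp only: mult.assoc) simp
      also have "\<dots> \<le> 2 powr 3 * Q powr (- 8 * \<gamma>)"
        using \<gamma> by (intro mult_right_mono powr_mono) auto
      finally show ?thesis by simp
    qed
    finally have Res: "Res \<le> 8 * Q powr (- 8 * \<gamma>) * C" using C by simp
    have "0 \<le> Res"
      unfolding Res_def by (rule sum_nonneg) (auto intro: cube_coeff_nonneg)
    define m where "m = real_of_int M"
    have m: "1 \<le> m" "Q ^ 20 \<le> m" using M M1 by (auto simp: m_def)
    define N where "N = 2 * m + 1"
    have N: "0 \<le> N" "N \<le> 3 * m" using m by (auto simp: N_def)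
    define L where "L = (\<Sum>j\<in>Lambda_freqs Q. \<bar>Lambda_coeff j\<bar>)"
    have L: "0 \<le> L" "L \<le> Q" using sum_abs_Lambda_coeff_le[OF Q0] by (auto simp: L_def intro: sum_nonneg)
    have lin: "Lambda_Q Q n = (\<Sum>j\<in>Lambda_freqs Q. of_real (Lambda_coeff j) * e (- (\<theta> j * of_int n)))" for n
      using Lambda_Q_eq[OF Q0] by (simp only: \<theta>_def P_def)
    define X where "X = Re (\<Sum>(x, h1, h2, h3)\<in>cube_region M. mult_derivs [h1, h2, h3] (Lambda_Q Q) x)"
    have "X \<le> N ^ 4 * Res + Q ^ 8 * N ^ 3 * L ^ 8"
      unfolding X_def N_def Res_def L_def m_def
    proof (rule cube_sum_le_resonant[where den = fst])
      fix j assume "j \<in> Lambda_freqs Q"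
      then obtain q a where j: "j = (q, a)" and mem: "(q, a) \<in> Lambda_freqs Q" by (metis surj_pair)
      note q = Lambda_freqs_mod[OF Q0 mem]
      show "0 < fst j" "real (fst j) \<le> Q" using q by (auto simp: j)
      have "real (fst j) * \<theta> j = real a"
        unfolding \<theta>_def P_def j Lambda_num_div[OF Q0 mem] using q by simp
      then show "real (fst j) * \<theta> j \<in> \<int>" by simp
    qed (use M1 in \<open>simp_all add: lin\<close>)
    also have "\<dots> \<le> (3 * m) ^ 4 * (8 * Q powr (- 8 * \<gamma>) * C) + Q ^ 8 * (3 * m) ^ 3 * Q ^ 8"
    proof -
      have "N ^ 4 \<le> (3 * m) ^ 4" "N ^ 3 \<le> (3 * m) ^ 3" "L ^ 8 \<le> Q ^ 8"
        by (intro power_mono N L)+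
      then show ?thesis
        using N L Q m Res \<open>0 \<le> Res\<close> by (intro add_mono mult_mono mult_nonneg_nonneg zero_le_power order_refl) simp_all
    qed
    \<comment> \<open>Sixteen powers of \<open>Q\<close> are lost, eight to denominators and eight
      to coefficients. As 16 + 8\<gamma> \<le> 20, the missing factor \<open>m \<ge> Q ^ 20\<close>
      compensates and still leaves the gain Q^(-8\<gamma>).\<close>
    also have "Q ^ 8 * (3 * m) ^ 3 * Q ^ 8 \<le> 27 * Q powr (- 8 * \<gamma>) * m ^ 4"
    proof -
      have "Q ^ 16 = Q powr 16" using Q by simp
      also have "\<dots> \<le> Q powr (20 + - 8 * \<gamma>)" using Q \<gamma> by (intro powr_mono) auto
      also have "\<dots> = Q ^ 20 * Q powr (- 8 * \<gamma>)"
        unfolding powr_add using Q by simp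
      also have "\<dots> \<le> m * Q powr (- 8 * \<gamma>)" using m by (intro mult_right_mono) auto
      finally have "27 * m ^ 3 * Q ^ 16 \<le> 27 * m ^ 3 * (m * Q powr (- 8 * \<gamma>))"
        using m by (intro mult_left_mono) auto
      moreover have "Q ^ 8 * (3 * m) ^ 3 * Q ^ 8 = 27 * m ^ 3 * Q ^ 16"
        by (simp add: power_mult_distrib flip: power_add)
      ultimately show ?thesis by (simp add: eval_nat_numeral mult_ac)
    qed
    also have "(3 * m) ^ 4 * (8 * Q powr (- 8 * \<gamma>) * C) + 27 * Q powr (- 8 * \<gamma>) * m ^ 4 =
      K * Q powr (- 8 * \<gamma>) * (M / 4) ^ 4"
      by (simp add: K_def m_def power_divide power_mult_distrib algebra_simps)
    also have "\<dots> \<le> K * Q powr (- 8 * \<gamma>) * card (cube_region M)"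
      using C by (intro mult_left_mono card_cube_region_ge M1) (auto simp: K_def)
    finally have X: "X \<le> K * Q powr (- 8 * \<gamma>) * card (cube_region M)" by simp
    have "0 < (real_of_int M / 4) ^ 4" using M1 by simp
    then have "0 < real (card (cube_region M))"
      using card_cube_region_ge[OF M1] by (rule less_le_trans)
    with X have "X / card (cube_region M) \<le> K * Q powr (- 8 * \<gamma>)"
      by (simp add: pos_divide_le_eq)
    then have "U3_norm_interval M (Lambda_Q Q) \<le> root 8 (K * Q powr (- 8 * \<gamma>))"
      unfolding U3_norm_interval_eq X_def[symmetric] by simp
    also have "\<dots> = root 8 K * root 8 ((Q powr (- \<gamma>)) ^ 8)"
      using Q by (simp add: real_root_mult powr_power mult.commute)
    also have "\<dots> = root 8 K * Q powr (- \<gamma>)"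
      by (simp add: real_root_power_cancel)
    also have "\<dots> \<le> root 8 K * Q powr (\<epsilon> - 3 / 8)"
      using Q C \<delta> by (intro mult_left_mono powr_mono) (auto simp: \<gamma>_def K_def)
    finally show ?thesis .
  qed
  then show ?thesis by blast
qed

end
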